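(* Let $a_0>0$ and $\mu>0$ be given. Then there exists $N\ge0$ such that \[\langle\phi,\phi\rangle_{G_g,a}\ge\mu\int_{-\infty}^\infty|\Phi_1(\phi,z)|^2\,dz\] for every $\phi\in\mathfrak{K}_{N,0}(a)$ and every $0<a\le a_0$.
   Context: $\Lambda$ is the von Mangoldt function, $G$ is Catalan's constant, $C=\pi^2+8G$, $\Phi(z,s,a)=\sum_{n\ge0}(n+a)^{-s}z^n$. For $t\ge0$, \[\Psi(t):=4(e^{t/2}+e^{-t/2}-2)-\sum_{n\le e^t}\frac{\Lambda(n)}{\sqrt n}(t-\log n)+\frac t2\Big[\frac{\Gamma'}{\Gamma}\Big(\frac14\Big)-\log\pi\Big]+\frac14\Big(C-e^{-t/2}\Phi(e^{-2t},2,1/4)\Big),\] extended evenly to $\mathbb{R}$; $g=-\Psi$, $G_g(t,u)=g(t-u)-g(t)-g(-u)+g(0)$, $\langle\phi_1,\phi_2\rangle_{G_g,a}=\int_{-a}^a\int_{-a}^aG_g(t,u)\phi_1(u)\overline{\phi_2(t)}\,du\,dt$. For $\phi\in L^2(-a,a)$ (extended by zero), $\widehat\phi(z)=\int\phi(t)e^{izt}dt$ and $\Phi_1(\phi,z)=(\widehat\phi(z)-\widehat\phi(0))/z=\int_{-a}^a\phi(t)\frac{e^{izt}-1}{z}dt$. $I_0^{(a)}(\phi)(t)=\int_{-a}^t\phi(u)\,du$. $K(a)$ is the set of functions $\psi$ on $\mathbb{R}$ with $\psi(t)=h(t)$ for $|t|\le a$ for some smooth $2a$-periodic $h$, and $\psi(t)=0$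 for $|t|>a$. $K_N(a)=\{\psi\in K(a):\int_{-a}^a\psi(x)e^{\pi inx/a}dx=0\text{ for all }n\in\mathbb{Z},|n|\le N\}$. $\mathfrak{K}_{N,0}(a)=\{\phi\in L^2(-a,a):\widehat\phi(0)=0,\ I_0^{(a)}(\phi)\in K_N(a)\}$. *)

theory Defs
  imports "HOL-Analysis.Analysis" "HOL-Number_Theory.Prime_Powers"
begin

definition catalan_G :: real where
  "catalan_G = (\<Sum>n. (-1) ^ n / (2 * real n + 1)\<^sup>2)"

definition lerch_Phi :: "real \<Rightarrow> real \<Rightarrow> real \<Rightarrow> real" where
  "lerch_Phi z s a = (\<Sum>n. (real n + a) powr (-s) * z ^ n)"

text \<open>Only meaningful for \<open>t \<ge> 0\<close>; \<open>Psi\<close> is its even extension.\<close>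

definition Psi_nonneg :: "real \<Rightarrow> real" where
  "Psi_nonneg t =
     4 * (exp (t/2) + exp (-t/2) - 2)
     - (\<Sum>n\<in>{n::nat. 1 \<le> n \<and> real n \<le> exp t}. mangoldt n / sqrt (real n) * (t - ln (real n)))
     + t/2 * (Digamma (1/4) - ln pi)
     + 1/4 * ((pi\<^sup>2 + 8 * catalan_G) - exp (-t/2) * lerch_Phi (exp (-2*t)) 2 (1/4))"

definition Psi :: "real \<Rightarrow> real" where
  "Psi t = Psi_nonneg \<bar>t\<bar>"

definition g :: "real \<Rightarrow> real" where
  "g t = - Psi t"

definition G_kernel :: "(real \<Rightarrow> real) \<Rightarrow> real \<Rightarrow> real \<Rightarrow> real" where
  "G_kernel f t u = f (t - u) - f t - f (-u) + f 0"

definition G_form :: "(real \<Rightarrow> real) \<Rightarrow> real \<Rightarrow> (real \<Rightarrow> complex) \<Rightarrow> (real \<Rightarrow> complex) \<Rightarrow> complex" where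
  "G_form f a \<phi>1 \<phi>2 =
     (LINT t:{-a..a}|lebesgue. (LINT u:{-a..a}|lebesgue.
        complex_of_real (G_kernel f t u) * \<phi>1 u * cnj (\<phi>2 t)))"

text \<open>Elements of \<open>L\<^sup>2(-a,a)\<close> are given by representatives that vanish off the open interval.\<close>

definition L2 :: "real \<Rightarrow> (real \<Rightarrow> complex) set" where
  "L2 a = {\<phi>. \<phi> \<in> borel_measurable lebesgue
             \<and> integrable lebesgue (\<lambda>t. (cmod (\<phi> t))\<^sup>2)
             \<and> (\<forall>t. t \<notin> {-a<..<a} \<longrightarrow> \<phi> t = 0)}"

definition fourier :: "(real \<Rightarrow> complex) \<Rightarrow> complex \<Rightarrow> complex" where
  "fourier \<phi> z = (LINT t|lebesgue. \<phi> t * exp (\<i> * z * complex_of_real t))"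

text \<open>At \<open>z = 0\<close> the quotient has a removable singularity, filled in by its limit.\<close>

definition Phi1 :: "(real \<Rightarrow> complex) \<Rightarrow> complex \<Rightarrow> complex" where
  "Phi1 \<phi> z =
     (if z = 0 then (LINT t|lebesgue. \<phi> t * (\<i> * complex_of_real t))
      else (fourier \<phi> z - fourier \<phi> 0) / z)"

definition I0 :: "real \<Rightarrow> (real \<Rightarrow> complex) \<Rightarrow> real \<Rightarrow> complex" where
  "I0 a \<phi> t = (LINT u=ereal (-a)..ereal t|lebesgue. \<phi> u)"

definition smooth :: "(real \<Rightarrow> complex) \<Rightarrow> bool" where
  "smooth h \<longleftrightarrow>
     (\<exists>D :: nat \<Rightarrow> real \<Rightarrow> complex. D 0 = h \<and>
        (\<forall>k t. (D k has_vector_derivative D (Suc k) t) (at t)))"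

definition K :: "real \<Rightarrow> (real \<Rightarrow> complex) set" where
  "K a = {\<psi>. \<exists>h. smooth h \<and> (\<forall>t. h (t + 2 * a) = h t)
            \<and> (\<forall>t. \<psi> t = (if \<bar>t\<bar> \<le> a then h t else 0))}"

definition K_N :: "nat \<Rightarrow> real \<Rightarrow> (real \<Rightarrow> complex) set" where
  "K_N N a = {\<psi> \<in> K a. \<forall>n::int. \<bar>n\<bar> \<le> int N \<longrightarrow>
     (LINT x:{-a..a}|lebesgue. \<psi> x * exp (pi * \<i> * of_int n * complex_of_real x / complex_of_real a)) = 0}"

definition frakK_N0 :: "nat \<Rightarrow> real \<Rightarrow> (real \<Rightarrow> complex) set" where
  "frakK_N0 N a = {\<phi> \<in> L2 a. fourier \<phi> 0 = 0 \<and> I0 a \<phi> \<in> K_N N a}"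

end

theory Submission
  imports Defs
begin

text \<open>
  Put \<open>\<psi> = I\<^sub>0 \<phi>\<close> and \<open>\<lambda>\<^sub>n = 2 n + 1/2\<close>. The Lerch part of \<open>g\<close> equals
  \<open>\<Sum>n. \<lambda>\<^sub>n\<^bsup>-2\<^esup> exp (-\<lambda>\<^sub>n \<bar>t\<bar>)\<close>, a sum of positive definite kernels, and integration by parts
  gives \<open>\<langle>\<phi>, \<phi>\<rangle> = 2 \<lambda> \<parallel>\<psi>\<parallel>\<^sup>2 - \<lambda>\<^sup>2 \<langle>\<psi>, \<psi>\<rangle>\<close> for the kernel \<open>exp (-\<lambda> \<bar>t\<bar>)\<close>. All terms with
  \<open>n \<ge> M\<close> are dropped by positivity. The first \<open>M\<close> terms contribute
  \<open>\<Sum>n<M. (2 / \<lambda>\<^sub>n) \<parallel>\<psi>\<parallel>\<^sup>2\<close>, which is as large a multiple of \<open>\<parallel>\<psi>\<parallel>\<^sup>2\<close> as desired because the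
  harmonic series diverges, minus \<open>\<Sum>n<M. \<langle>\<psi>, \<psi>\<rangle>\<close>. If \<open>F\<close> is the primitive of \<open>\<psi>\<close>, the same identity one level
  up bounds each \<open>\<langle>\<psi>, \<psi>\<rangle>\<close> by \<open>2 \<lambda>\<^sub>n \<parallel>F\<parallel>\<^sup>2\<close>, and \<open>\<parallel>F\<parallel>\<close> is small compared with \<open>\<parallel>\<psi>\<parallel>\<close> once \<open>\<psi>\<close> is
  orthogonal to the low frequencies: \<open>F t\<close> is the inner product of \<open>\<psi>\<close> with the indicator of \<open>{-a..t}\<close>,
  whose Fourier tails have total mass given by the tail of the Basel series.
  The remaining parts of \<open>g\<close> (hyperbolic cosine, \<open>\<bar>t\<bar>\<close> and the finitely many translates coming from the
  prime powers up to \<open>exp (2 a\<^sub>0)\<close>) are bounded by a constant times \<open>\<parallel>\<psi>\<parallel>\<^sup>2\<close>. Finally \<open>\<bar>\<Phi>\<^sub>1\<bar>\<close> is the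
  modulus of the Fourier transform of \<open>\<psi>\<close>.
\<close>

subsection \<open>Quadratic forms of difference kernels\<close>

text \<open>Gauge integrals are enough because these forms are evaluated at continuous
  representatives; \<open>G_form_eq_form\<close> links them with the Lebesgue integrals in
  \<open>G_form\<close>.\<close>

definition conv :: "real \<Rightarrow> (real \<Rightarrow> real) \<Rightarrow> (real \<Rightarrow> complex) \<Rightarrow> real \<Rightarrow> complex" where
  "conv a k \<phi> t = integral {-a..a} (\<lambda>u. of_real (k (t - u)) * \<phi> u)"

definition form :: "real \<Rightarrow> (real \<Rightarrow> real) \<Rightarrow> (real \<Rightarrow> complex) \<Rightarrow> complex" where
  "form a k \<phi> = integral {-a..a} (\<lambda>t. conv a k \<phi> t * cnj (\<phi> t))"

definition sqnorm :: "real \<Rightarrow> (real \<Rightarrow> complex) \<Rightarrow> real" where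
  "sqnorm a f = integral {-a..a} (\<lambda>t. (cmod (f t))\<^sup>2)"

text \<open>Zero values at both ends remove the boundary terms from the integrations by parts below.
  The derivative is required only in the open interval, which is what an indefinite integral of a
  function continuous on \<open>{-a..a}\<close> provides.\<close>

definition vanishing_primitive :: "real \<Rightarrow> (real \<Rightarrow> complex) \<Rightarrow> (real \<Rightarrow> complex) \<Rightarrow> bool" where
  "vanishing_primitive a f f' \<longleftrightarrow> continuous_on {-a..a} f \<and> continuous_on {-a..a} f' \<and>
     (\<forall>t\<in>{-a<..<a}. (f has_vector_derivative f' t) (at t)) \<and> f (-a) = 0 \<and> f a = 0"

text \<open>The fundamental theorem tolerates finitely many exceptional points, and integrability of
  one of the two products gives that of the other by subtraction. The set \<open>S\<close> is there
  for the kernel \<open>\<bar>x - l\<bar>\<close>, whose convolution is differentiated only off two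
  points.\<close>

lemma integral_by_parts_except_finite:
  fixes f g :: "real \<Rightarrow> complex"
  assumes "finite S" "a \<le> b" "continuous_on {a..b} f" "continuous_on {a..b} g"
    and "\<And>x. x \<in> {a<..<b} - S \<Longrightarrow> (f has_vector_derivative f' x) (at x)"
    and "\<And>x. x \<in> {a<..<b} - S \<Longrightarrow> (g has_vector_derivative g' x) (at x)"
    and "(\<lambda>x. f' x * g x) integrable_on {a..b}"
  shows "integral {a..b} (\<lambda>x. f x * g' x) = f b * g b - f a * g a - integral {a..b} (\<lambda>x. f' x * g x)"
proof -
  have "((\<lambda>x. f x * g' x + f' x * g x) has_integral (f b * g b - f a * g a)) {a..b}"
    by (rule fundamental_theorem_of_calculus_interior_strong[OF assms(1,2)])
       (auto intro!: has_vector_derivative_mult continuous_intros assms)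
  from has_integral_diff[OF this integrable_integral[OF assms(7)]]
  show ?thesis by (simp add: integral_unique)
qed

lemma integral_by_parts_complex:
  fixes f g :: "real \<Rightarrow> complex"
  assumes "a \<le> b" "continuous_on {a..b} f" "continuous_on {a..b} g" "continuous_on {a..b} f'"
    and "\<And>x. x \<in> {a<..<b} \<Longrightarrow> (f has_vector_derivative f' x) (at x)"
    and "\<And>x. x \<in> {a<..<b} \<Longrightarrow> (g has_vector_derivative g' x) (at x)"
  shows "integral {a..b} (\<lambda>x. f x * g' x) = f b * g b - f a * g a - integral {a..b} (\<lambda>x. f' x * g x)"
  by (rule integral_by_parts_except_finite[where S="{}"])
     (auto intro!: assms integrable_continuous_real continuous_intros)

lemma continuous_on_conv:
  assumes "continuous_on UNIV k" "continuous_on {-a..a} \<phi>"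
  shows "continuous_on S (conv a k \<phi>)"
proof -
  have "continuous_on (S \<times> cbox (-a) a) (\<lambda>(t, u). of_real (k (t - u)) * \<phi> u)"
    unfolding split_def
    by (auto intro!: continuous_intros continuous_on_compose2[OF assms(1)] continuous_on_compose2[OF assms(2)])
  from integral_continuous_on_param[OF this] show ?thesis
    by (simp add: conv_def[abs_def])
qed

lemma integrable_conv:
  fixes \<phi> :: "real \<Rightarrow> complex"
  assumes "continuous_on UNIV k" "continuous_on {-a..a} \<phi>"
  shows "(\<lambda>u. of_real (k (t - u)) * \<phi> u) integrable_on {-a..a}"
  by (auto intro!: integrable_continuous_real continuous_intros assms continuous_on_compose2[OF assms(1)])

lemma integrable_form:
  assumes "continuous_on UNIV k" "continuous_on {-a..a} \<phi>"
  shows "(\<lambda>t. conv a k \<phi> t * cnj (\<phi> t)) integrable_on {-a..a}"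
  by (auto intro!: integrable_continuous_real continuous_intros assms continuous_on_conv)

lemma form_add:
  assumes "continuous_on UNIV k" "continuous_on UNIV l" "continuous_on {-a..a} \<phi>"
  shows "form a (\<lambda>x. k x + l x) \<phi> = form a k \<phi> + form a l \<phi>"
proof -
  have "conv a (\<lambda>x. k x + l x) \<phi> t = conv a k \<phi> t + conv a l \<phi> t" for t
    using Henstock_Kurzweil_Integration.integral_add[OF integrable_conv[OF assms(1,3), of t] integrable_conv[OF assms(2,3), of t]]
    by (simp add: conv_def algebra_simps)
  then show ?thesis
    using Henstock_Kurzweil_Integration.integral_add[OF integrable_form[OF assms(1,3)] integrable_form[OF assms(2,3)]]
    by (simp add: form_def algebra_simps)
qed

lemma form_cmult: "form a (\<lambda>x. c * k x) \<phi> = of_real c * form a k \<phi>"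
proof -
  have "conv a (\<lambda>x. c * k x) \<phi> t = of_real c * conv a k \<phi> t" for t
    unfolding conv_def by (simp add: integral_mult_right[symmetric] mult.assoc del: integral_mult_right)
  then show ?thesis
    unfolding form_def by (simp add: integral_mult_right[symmetric] mult.assoc del: integral_mult_right)
qed

lemma form_0 [simp]: "form a (\<lambda>x. 0) \<phi> = 0"
  by (simp add: form_def conv_def)

lemma form_sum:
  assumes "finite I" "\<And>i. i \<in> I \<Longrightarrow> continuous_on UNIV (k i)" "continuous_on {-a..a} \<phi>"
  shows "form a (\<lambda>x. \<Sum>i\<in>I. k i x) \<phi> = (\<Sum>i\<in>I. form a (k i) \<phi>)"
  using assms(1,2)
proof (induction I rule: finite_induct)
  case (insert i I)
  then show ?case
    using form_add[of "k i" "\<lambda>x. \<Sum>i\<in>I. k i x" a \<phi>] assms(3) by (auto intro!: continuous_on_sum)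
qed simp

text \<open>Conjugating the integrand of an even kernel amounts to swapping the two variables, and
  continuity permits exchanging the order of integration.\<close>

lemma form_in_Reals:
  assumes "continuous_on UNIV k" "\<And>x. k (-x) = k x" "continuous_on {-a..a} \<phi>"
  shows "form a k \<phi> \<in> \<real>"
proof -
  let ?K = "\<lambda>t u. of_real (k (t - u)) * \<phi> u * cnj (\<phi> t)"
  have form: "form a k \<phi> = integral {-a..a} (\<lambda>t. integral {-a..a} (?K t))"
    unfolding form_def conv_def by simp
  have "cnj (form a k \<phi>) = integral {-a..a} (\<lambda>t. integral {-a..a} (\<lambda>u. cnj (?K t u)))"
    unfolding form by (simp add: integral_cnj)
  also have "\<dots> = integral {-a..a} (\<lambda>t. integral {-a..a} (\<lambda>u. ?K u t))"
    by (intro integral_cong) (simp, metis assms(2) minus_diff_eq mult.commute mult.assoc)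
  also have "\<dots> = integral (cbox (-a) a) (\<lambda>t. integral (cbox (-a) a) (?K t))"
    unfolding cbox_interval[symmetric]
    by (rule integral_swap_continuous[of "-a" "-a" a a ?K, symmetric])
       (auto simp: split_def intro!: continuous_intros continuous_on_compose2[OF assms(1)]
          continuous_on_compose2[OF assms(3)])
  finally show ?thesis unfolding form by (simp add: Reals_cnj_iff)
qed

text \<open>One integration by parts moves the derivative from the factor \<open>cnj (f' t)\<close>
  onto the convolution. For each kernel it then remains to differentiate
  \<open>conv a k f'\<close>.\<close>

lemma form_vanishing_primitive:
  assumes f: "vanishing_primitive a f f'" "0 < a" and k: "continuous_on UNIV k"
    and "finite S" "\<And>t. t \<in> {-a<..<a} - S \<Longrightarrow> (conv a k f' has_vector_derivative D t) (at t)"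
    and "(\<lambda>t. D t * cnj (f t)) integrable_on {-a..a}"
  shows "form a k f' = - integral {-a..a} (\<lambda>t. D t * cnj (f t))"
proof -
  have "integral {-a..a} (\<lambda>t. conv a k f' t * cnj (f' t)) =
    conv a k f' a * cnj (f a) - conv a k f' (-a) * cnj (f (-a)) - integral {-a..a} (\<lambda>t. D t * cnj (f t))"
    using f assms(4-) unfolding vanishing_primitive_def
    by (intro integral_by_parts_except_finite[where S=S])
       (auto intro!: continuous_on_conv k continuous_intros has_vector_derivative_cnj)
  with f(1) show ?thesis by (simp add: form_def vanishing_primitive_def)
qed

lemma integral_deriv_mult_vanishing_primitive:
  assumes f: "vanishing_primitive a f f'" "0 < a"
    and "continuous_on {-a..a} e" "continuous_on {-a..a} e'"
    "\<And>t. t \<in> {-a<..<a} \<Longrightarrow> (e has_vector_derivative e' t) (at t)"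
  shows "integral {-a..a} (\<lambda>t. e t * f' t) = - integral {-a..a} (\<lambda>t. e' t * f t)"
  using f integral_by_parts_complex[of "-a" a e f e' f'] assms(3-) by (auto simp: vanishing_primitive_def)

lemma vanishing_primitive_cnj:
  "vanishing_primitive a f f' \<Longrightarrow> vanishing_primitive a (\<lambda>t. cnj (f t)) (\<lambda>t. cnj (f' t))"
  by (auto simp: vanishing_primitive_def intro!: continuous_intros has_vector_derivative_cnj)

subsection \<open>The exponential kernels\<close>

lemma has_vector_derivative_integral_interior:
  fixes f :: "real \<Rightarrow> complex"
  assumes "continuous_on {a..b} f" "x \<in> {a<..<b}"
  shows "((\<lambda>u. integral {a..u} f) has_vector_derivative f x) (at x)"
  using integral_has_vector_derivative[OF assms(1), of x] assms(2)
  by (simp add: at_within_Icc_at)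

lemma has_vector_derivative_of_real_exp:
  "((\<lambda>u. complex_of_real (exp (c * u))) has_vector_derivative of_real c * of_real (exp (c * x))) (at x)"
proof -
  have "((\<lambda>u. exp (c * u)) has_real_derivative c * exp (c * x)) (at x)"
    by (auto intro!: derivative_eq_intros)
  from has_vector_derivative_of_real[OF this] show ?thesis by simp
qed

definition exp_integral :: "real \<Rightarrow> real \<Rightarrow> (real \<Rightarrow> complex) \<Rightarrow> real \<Rightarrow> complex" where
  "exp_integral c a \<phi> t = integral {-a..t} (\<lambda>u. of_real (exp (c * u)) * \<phi> u)"

lemma continuous_on_exp_integral:
  assumes "continuous_on {-a..a} \<phi>"
  shows "continuous_on {-a..a} (exp_integral c a \<phi>)"
  unfolding exp_integral_def
  by (rule indefinite_integral_continuous_1)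
     (auto intro!: integrable_continuous_real continuous_intros assms)

lemma has_vector_derivative_exp_integral:
  assumes "continuous_on {-a..a} \<phi>" "t \<in> {-a<..<a}"
  shows "(exp_integral c a \<phi> has_vector_derivative of_real (exp (c * t)) * \<phi> t) (at t)"
  unfolding exp_integral_def
  by (rule has_vector_derivative_integral_interior[where b=a])
     (auto intro!: continuous_intros assms simp del: of_real_exp simp: assms(2)[simplified])

lemma exp_integral_deriv:
  assumes f: "vanishing_primitive a f f'" and t: "t \<in> {-a..a}"
  shows "exp_integral c a f' t = of_real (exp (c * t)) * f t - of_real c * exp_integral c a f t"
proof -
  have "integral {-a..t} (\<lambda>x. of_real (exp (c * x)) * f' x) =
     of_real (exp (c * t)) * f t - of_real (exp (c * (-a))) * f (-a)
     - integral {-a..t} (\<lambda>x. (of_real c * of_real (exp (c * x))) * f x)"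
    using f t
    by (intro integral_by_parts_complex has_vector_derivative_of_real_exp)
       (auto simp: vanishing_primitive_def simp del: of_real_exp
          intro!: continuous_intros elim: continuous_on_subset)
  also have "\<dots> = of_real (exp (c * t)) * f t - of_real c * exp_integral c a f t"
    using f by (simp add: exp_integral_def vanishing_primitive_def mult.assoc)
  finally show ?thesis by (simp add: exp_integral_def)
qed

text \<open>The two one-sided halves of the convolution with \<open>exp (-\<kappa> \<bar>t\<bar>)\<close>. They solve
  \<open>A' = \<phi> - \<kappa> A\<close> and \<open>B' = \<kappa> B - \<phi>\<close>, which gives positivity without any Fourier analysis.\<close>

definition exp_past :: "real \<Rightarrow> real \<Rightarrow> (real \<Rightarrow> complex) \<Rightarrow> real \<Rightarrow> complex" where
  "exp_past \<kappa> a \<phi> t = of_real (exp (- \<kappa> * t)) * exp_integral \<kappa> a \<phi> t"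

definition exp_future :: "real \<Rightarrow> real \<Rightarrow> (real \<Rightarrow> complex) \<Rightarrow> real \<Rightarrow> complex" where
  "exp_future \<kappa> a \<phi> t =
     of_real (exp (\<kappa> * t)) * (exp_integral (-\<kappa>) a \<phi> a - exp_integral (-\<kappa>) a \<phi> t)"

lemma continuous_on_exp_past_future:
  assumes "continuous_on {-a..a} \<phi>"
  shows "continuous_on {-a..a} (exp_past \<kappa> a \<phi>)" "continuous_on {-a..a} (exp_future \<kappa> a \<phi>)"
  unfolding exp_past_def[abs_def] exp_future_def[abs_def]
  by (auto intro!: continuous_intros continuous_on_exp_integral assms simp del: of_real_exp)

lemma exp_past_future_boundary: "exp_past \<kappa> a \<phi> (-a) = 0" "exp_future \<kappa> a \<phi> a = 0"
  by (simp_all add: exp_past_def exp_future_def exp_integral_def)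

lemma of_real_exp_cancel: "complex_of_real (exp x) * of_real (exp (-x)) = 1"
  by (simp flip: of_real_mult exp_add del: of_real_exp)

lemma has_vector_derivative_exp_past:
  assumes "continuous_on {-a..a} \<phi>" "t \<in> {-a<..<a}"
  shows "(exp_past \<kappa> a \<phi> has_vector_derivative \<phi> t - of_real \<kappa> * exp_past \<kappa> a \<phi> t) (at t)"
proof -
  have d: "(exp_past \<kappa> a \<phi> has_vector_derivative
      of_real (exp (- \<kappa> * t)) * (of_real (exp (\<kappa> * t)) * \<phi> t)
      + of_real (-\<kappa>) * of_real (exp (- \<kappa> * t)) * exp_integral \<kappa> a \<phi> t) (at t)"
    unfolding exp_past_def[abs_def]
    by (intro has_vector_derivative_mult has_vector_derivative_of_real_exp
        has_vector_derivative_exp_integral assms)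
  have eq: "of_real (exp (- \<kappa> * t)) * (of_real (exp (\<kappa> * t)) * \<phi> t) = \<phi> t"
    using of_real_exp_cancel[of "- \<kappa> * t"] by (simp add: mult.assoc[symmetric] del: of_real_exp)
  show ?thesis
    using d unfolding eq by (simp add: exp_past_def mult.assoc del: of_real_exp)
qed

lemma has_vector_derivative_exp_future:
  assumes "continuous_on {-a..a} \<phi>" "t \<in> {-a<..<a}"
  shows "(exp_future \<kappa> a \<phi> has_vector_derivative of_real \<kappa> * exp_future \<kappa> a \<phi> t - \<phi> t) (at t)"
proof -
  have d: "(exp_future \<kappa> a \<phi> has_vector_derivative
      of_real (exp (\<kappa> * t)) * (0 - of_real (exp (- \<kappa> * t)) * \<phi> t)
      + of_real \<kappa> * of_real (exp (\<kappa> * t)) * (exp_integral (-\<kappa>) a \<phi> a - exp_integral (-\<kappa>) a \<phi> t)) (at t)"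
    unfolding exp_future_def[abs_def]
    by (intro has_vector_derivative_mult has_vector_derivative_of_real_exp has_vector_derivative_diff
        has_vector_derivative_const has_vector_derivative_exp_integral assms)
  have eq: "of_real (exp (\<kappa> * t)) * (0 - of_real (exp (- \<kappa> * t)) * \<phi> t) = - \<phi> t"
    using of_real_exp_cancel[of "\<kappa> * t"] by (simp add: mult.assoc[symmetric] del: of_real_exp)
  show ?thesis
    using d unfolding eq by (simp add: exp_future_def mult.assoc del: of_real_exp)
qed

text \<open>On either side of \<open>u = t\<close> the sign of \<open>t - u\<close> is fixed, so the
  exponential splits into a factor in \<open>t\<close> times a factor in \<open>u\<close>.\<close>

lemma conv_exp_abs:
  assumes "continuous_on {-a..a} \<phi>" "t \<in> {-a..a}"
  shows "conv a (\<lambda>x. exp (- (\<kappa> * \<bar>x\<bar>))) \<phi> t = exp_past \<kappa> a \<phi> t + exp_future \<kappa> a \<phi> t"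
proof -
  let ?g = "\<lambda>u. of_real (exp (- (\<kappa> * \<bar>t - u\<bar>))) * \<phi> u"
  have "conv a (\<lambda>x. exp (- (\<kappa> * \<bar>x\<bar>))) \<phi> t = integral {-a..t} ?g + integral {t..a} ?g"
    unfolding conv_def using assms
    by (intro Henstock_Kurzweil_Integration.integral_combine[symmetric])
       (auto intro!: integrable_continuous_real continuous_intros simp del: of_real_exp)
  also have "integral {-a..t} ?g = integral {-a..t} (\<lambda>u. of_real (exp (- \<kappa> * t)) * (of_real (exp (\<kappa> * u)) * \<phi> u))"
    by (intro integral_cong)
       (auto simp: algebra_simps simp flip: exp_add of_real_mult of_real_exp)
  also have "\<dots> = exp_past \<kappa> a \<phi> t"
    by (simp add: exp_past_def exp_integral_def)
  also have "integral {t..a} ?g = integral {t..a} (\<lambda>u. of_real (exp (\<kappa> * t)) * (of_real (exp (- \<kappa> * u)) * \<phi> u))"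
    by (intro integral_cong)
       (auto simp: algebra_simps simp flip: exp_add of_real_mult of_real_exp)
  also have "\<dots> = of_real (exp (\<kappa> * t)) * integral {t..a} (\<lambda>u. of_real (exp (- \<kappa> * u)) * \<phi> u)"
    by simp
  also have "integral {t..a} (\<lambda>u. of_real (exp (- \<kappa> * u)) * \<phi> u) = exp_integral (-\<kappa>) a \<phi> a - exp_integral (-\<kappa>) a \<phi> t"
  proof -
    have "exp_integral (-\<kappa>) a \<phi> t + integral {t..a} (\<lambda>u. of_real (exp (- \<kappa> * u)) * \<phi> u) = exp_integral (-\<kappa>) a \<phi> a"
      unfolding exp_integral_def using assms
      by (intro Henstock_Kurzweil_Integration.integral_combine)
         (auto intro!: integrable_continuous_real continuous_intros simp del: of_real_exp)
    then show ?thesis by (simp add: algebra_simps)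
  qed
  finally show ?thesis by (simp add: exp_future_def)
qed

lemma integral_cmod_sq:
  assumes "continuous_on {-a..a} f"
  shows "integral {-a..a} (\<lambda>t. complex_of_real c * of_real ((cmod (f t))\<^sup>2)) = of_real (c * sqnorm a f)"
  unfolding sqnorm_def of_real_mult integral_mult_right
  by (intro arg_cong2[of _ _ _ _ "(*)"] refl integral_unique has_integral_of_real integrable_integral
     integrable_continuous_real continuous_intros assms)

text \<open>Energy method for \<open>I\<close>, the integral of \<open>A\<close> times the conjugate
  of its derivative. By parts, \<open>2 * Re I\<close> is the difference of the boundary values of
  \<open>(cmod (A t))\<^sup>2\<close>; inserting the differential equation turns the same
  \<open>I\<close> into the wanted integral minus \<open>\<kappa> * sqnorm a A\<close>, up to the
  sign \<open>s\<close>, which is the direction of time. As \<open>A\<close> vanishes at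
  \<open>- s * a\<close>, the surviving boundary term has the right sign.\<close>

lemma Re_integral_nonneg_dissipative:
  fixes A \<phi> :: "real \<Rightarrow> complex"
  assumes a: "0 < a" and \<kappa>: "0 \<le> \<kappa>" and A: "continuous_on {-a..a} A" and \<phi>: "continuous_on {-a..a} \<phi>"
    and s: "s = 1 \<or> s = -1"
    and deriv: "\<And>t. t \<in> {-a<..<a} \<Longrightarrow> (A has_vector_derivative of_real s * (\<phi> t - of_real \<kappa> * A t)) (at t)"
    and "A (- s * a) = 0"
  shows "0 \<le> Re (integral {-a..a} (\<lambda>t. A t * cnj (\<phi> t)))"
proof -
  let ?D = "\<lambda>t. of_real s * (\<phi> t - of_real \<kappa> * A t)"
  define I where "I = integral {-a..a} (\<lambda>t. A t * cnj (?D t))"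
  have "I = A a * cnj (A a) - A (-a) * cnj (A (-a)) - integral {-a..a} (\<lambda>t. ?D t * cnj (A t))"
    unfolding I_def
    using a by (intro integral_by_parts_complex deriv has_vector_derivative_cnj) (auto intro!: continuous_intros A \<phi>)
  also have "integral {-a..a} (\<lambda>t. ?D t * cnj (A t)) = cnj I"
    unfolding I_def integral_cnj by (simp add: mult.commute)
  finally have I: "2 * Re I = (cmod (A a))\<^sup>2 - (cmod (A (-a)))\<^sup>2"
    unfolding complex_norm_square[symmetric] by (simp add: complex_eq_iff flip: of_real_power)
  have "A t * cnj (?D t) = of_real s * (A t * cnj (\<phi> t)) - of_real (s * \<kappa>) * of_real ((cmod (A t))\<^sup>2)" for t
    unfolding complex_norm_square by (simp add: algebra_simps)
  then have "I = integral {-a..a} (\<lambda>t. of_real s * (A t * cnj (\<phi> t)) - of_real (s * \<kappa>) * of_real ((cmod (A t))\<^sup>2))"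
    unfolding I_def by simp
  also have "\<dots> = integral {-a..a} (\<lambda>t. of_real s * (A t * cnj (\<phi> t)))
        - integral {-a..a} (\<lambda>t. of_real (s * \<kappa>) * of_real ((cmod (A t))\<^sup>2))"
    by (intro Henstock_Kurzweil_Integration.integral_diff)
       (auto intro!: integrable_continuous_real continuous_intros A \<phi>)
  also have "\<dots> = of_real s * integral {-a..a} (\<lambda>t. A t * cnj (\<phi> t)) - of_real (s * \<kappa> * sqnorm a A)"
    unfolding integral_cmod_sq[OF A] unfolding integral_mult_right ..
  finally have "I = of_real s * integral {-a..a} (\<lambda>t. A t * cnj (\<phi> t)) - of_real (s * \<kappa> * sqnorm a A)" .
  with I have *: "2 * s * Re (integral {-a..a} (\<lambda>t. A t * cnj (\<phi> t))) =
       2 * s * \<kappa> * sqnorm a A + (cmod (A a))\<^sup>2 - (cmod (A (-a)))\<^sup>2"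
    by simp
  define q where "q = \<kappa> * sqnorm a A"
  have "2 * s * Re (integral {-a..a} (\<lambda>t. A t * cnj (\<phi> t))) =
       2 * s * q + (cmod (A a))\<^sup>2 - (cmod (A (-a)))\<^sup>2"
    using * by (simp add: q_def)
  moreover have "0 \<le> q"
    unfolding q_def sqnorm_def using \<kappa> by (intro mult_nonneg_nonneg integral_nonneg integrable_continuous_real continuous_intros A) auto
  ultimately have "0 \<le> s * (s * Re (integral {-a..a} (\<lambda>t. A t * cnj (\<phi> t))))"
    using s assms(7) by (elim disjE; hypsubst) (simp, smt (verit) zero_le_power2)+
  then show ?thesis using s by auto
qed

text \<open>The past and the future halves are nonnegative separately, by the energy estimate with
  \<open>s = 1\<close> and \<open>s = -1\<close>.\<close>

lemma Re_form_exp_abs_nonneg: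
  assumes "0 < a" "0 \<le> \<kappa>" "continuous_on {-a..a} \<phi>"
  shows "0 \<le> Re (form a (\<lambda>x. exp (- (\<kappa> * \<bar>x\<bar>))) \<phi>)"
proof -
  have "form a (\<lambda>x. exp (- (\<kappa> * \<bar>x\<bar>))) \<phi> =
     integral {-a..a} (\<lambda>t. exp_past \<kappa> a \<phi> t * cnj (\<phi> t) + exp_future \<kappa> a \<phi> t * cnj (\<phi> t))"
    unfolding form_def by (intro integral_cong) (simp add: conv_exp_abs[OF assms(3)] algebra_simps)
  also have "\<dots> = integral {-a..a} (\<lambda>t. exp_past \<kappa> a \<phi> t * cnj (\<phi> t)) + integral {-a..a} (\<lambda>t. exp_future \<kappa> a \<phi> t * cnj (\<phi> t))"
    by (intro Henstock_Kurzweil_Integration.integral_add)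
       (auto intro!: integrable_continuous_real continuous_intros continuous_on_exp_past_future assms)
  finally show ?thesis
    using Re_integral_nonneg_dissipative[OF assms(1,2) continuous_on_exp_past_future(1)[OF assms(3)] assms(3), of 1 \<kappa>]
      Re_integral_nonneg_dissipative[OF assms(1,2) continuous_on_exp_past_future(2)[OF assms(3)] assms(3), of "-1" \<kappa>]
      has_vector_derivative_exp_past[OF assms(3)] has_vector_derivative_exp_future[OF assms(3)]
    by (simp add: exp_past_future_boundary)
qed

text \<open>Formally, the second derivative of \<open>exp (- (\<kappa> * \<bar>x\<bar>))\<close> is
  \<open>\<kappa>\<^sup>2\<close> times itself minus \<open>2 * \<kappa>\<close> times the point
  mass at 0, and the point mass yields \<open>sqnorm a f\<close>. The first-order equations of the
  two halves make this rigorous.\<close>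

lemma form_exp_abs_deriv:
  assumes f: "vanishing_primitive a f f'" and a: "0 < a"
  shows "form a (\<lambda>x. exp (- (\<kappa> * \<bar>x\<bar>))) f' =
    of_real (2 * \<kappa> * sqnorm a f) - of_real (\<kappa>\<^sup>2) * form a (\<lambda>x. exp (- (\<kappa> * \<bar>x\<bar>))) f"
proof -
  let ?k = "\<lambda>x. exp (- (\<kappa> * \<bar>x\<bar>))"
  let ?C = "\<lambda>t. of_real \<kappa> * (exp_future \<kappa> a f t - exp_past \<kappa> a f t)"
  let ?D = "\<lambda>t. of_real (\<kappa>\<^sup>2) * conv a ?k f t - of_real (2 * \<kappa>) * f t"
  have cf: "continuous_on {-a..a} f" "continuous_on {-a..a} f'" and fa: "f a = 0"
    using f by (auto simp: vanishing_primitive_def)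
  have ck: "continuous_on UNIV ?k" by (intro continuous_intros)
  \<comment> \<open>The terms \<open>f t\<close> and \<open>- f t\<close> that the two halves
    produce by parts cancel.\<close>
  have conv: "conv a ?k f' t = ?C t" if t: "t \<in> {-a..a}" for t
  proof -
    define x y where "x = complex_of_real (exp (\<kappa> * t))" and "y = complex_of_real (exp (- \<kappa> * t))"
    have yx: "y * x = 1" "x * y = 1"
      using of_real_exp_cancel[of "\<kappa> * t"] by (simp_all add: x_def y_def mult.commute)
    have "exp_past \<kappa> a f' t = (y * x) * f t - of_real \<kappa> * (y * exp_integral \<kappa> a f t)"
      unfolding exp_past_def exp_integral_deriv[OF f t] x_def[symmetric] y_def[symmetric]
      by (simp only: right_diff_distrib mult_ac)
    moreover have "exp_future \<kappa> a f' t =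
        of_real \<kappa> * (x * (exp_integral (-\<kappa>) a f a - exp_integral (-\<kappa>) a f t)) - (x * y) * f t"
    proof -
      have "exp_integral (-\<kappa>) a f' a = of_real \<kappa> * exp_integral (-\<kappa>) a f a"
        using exp_integral_deriv[OF f, of a "-\<kappa>"] a fa by simp
      moreover have "exp_integral (-\<kappa>) a f' t = y * f t + of_real \<kappa> * exp_integral (-\<kappa>) a f t"
        using exp_integral_deriv[OF f t, of "-\<kappa>"] by (simp add: y_def)
      ultimately show ?thesis
        unfolding exp_future_def x_def[symmetric] by (simp only: right_diff_distrib distrib_left mult_ac)
           (simp add: algebra_simps)
    qed
    ultimately have "exp_past \<kappa> a f' t + exp_future \<kappa> a f' t = ?C t"
      unfolding yx exp_past_def[of _ _ f] exp_future_def[of _ _ f] x_def[symmetric] y_def[symmetric]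
      by (simp add: right_diff_distrib)
    then show ?thesis by (simp add: conv_exp_abs[OF cf(2) t])
  qed
  have "form a ?k f' = - integral {-a..a} (\<lambda>t. ?D t * cnj (f t))"
  proof (rule form_vanishing_primitive[OF f a ck, where S="{}"])
    fix t assume t: "t \<in> {-a<..<a} - {}"
    have "(?C has_vector_derivative of_real \<kappa> *
        ((of_real \<kappa> * exp_future \<kappa> a f t - f t) - (f t - of_real \<kappa> * exp_past \<kappa> a f t))) (at t)"
      using t by (intro has_vector_derivative_mult_right has_vector_derivative_diff
        has_vector_derivative_exp_past has_vector_derivative_exp_future cf) auto
    then have "(?C has_vector_derivative ?D t) (at t)"
      using t by (simp add: conv_exp_abs[OF cf(1)] algebra_simps power2_eq_square)
    then show "(conv a ?k f' has_vector_derivative ?D t) (at t)"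
      by (rule has_vector_derivative_transform_within_open[where S="{-a<..<a}"]) (use t conv in auto)
  qed (auto intro!: integrable_continuous_real continuous_intros continuous_on_conv cf)
  also have "integral {-a..a} (\<lambda>t. ?D t * cnj (f t)) =
      integral {-a..a} (\<lambda>t. of_real (\<kappa>\<^sup>2) * (conv a ?k f t * cnj (f t)) - of_real (2 * \<kappa>) * of_real ((cmod (f t))\<^sup>2))"
    by (simp only: complex_norm_square) (simp add: algebra_simps)
  also have "\<dots> = integral {-a..a} (\<lambda>t. of_real (\<kappa>\<^sup>2) * (conv a ?k f t * cnj (f t)))
      - integral {-a..a} (\<lambda>t. of_real (2 * \<kappa>) * of_real ((cmod (f t))\<^sup>2))"
    by (intro Henstock_Kurzweil_Integration.integral_diff)
       (auto intro!: integrable_continuous_real continuous_intros continuous_on_conv cf)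
  also have "\<dots> = of_real (\<kappa>\<^sup>2) * form a ?k f - of_real (2 * \<kappa> * sqnorm a f)"
    unfolding integral_cmod_sq[OF cf(1)] unfolding integral_mult_right form_def ..
  finally show ?thesis by simp
qed

subsection \<open>Cauchy--Schwarz and the kernels \<open>exp (c x)\<close>\<close>

text \<open>Discriminant argument with the optimal choice \<open>r = I / P\<close>; for
  \<open>P = 0\<close> a positive \<open>I\<close> is refuted by
  \<open>r = (Q + 1) / (2 * I)\<close>.\<close>

lemma square_le_mult_of_quadratic:
  fixes I P Q :: real
  assumes "0 \<le> I" "0 \<le> P" "0 \<le> Q" "\<And>r. 0 < r \<Longrightarrow> 2 * I * r \<le> r\<^sup>2 * P + Q"
  shows "I\<^sup>2 \<le> P * Q"
proof (cases "I = 0")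
  case False
  then have I: "0 < I" using assms(1) by simp
  show ?thesis
  proof (cases "P = 0")
    case True
    then have "2 * I * ((Q + 1) / (2 * I)) \<le> Q"
      using assms(4)[of "(Q + 1) / (2 * I)"] I assms(3) by simp
    then show ?thesis using I by simp
  next
    case False
    then have P: "0 < P" using assms(2) by simp
    from assms(4)[of "I / P"] have "2 * I * (I / P) \<le> (I / P)\<^sup>2 * P + Q" using I P by simp
    with P show ?thesis by (simp add: field_simps power2_eq_square)
  qed
qed (use assms in simp)

text \<open>Only integrability is assumed, since one of the later factors is an indicator function
  minus a trigonometric polynomial. The pointwise inequality
  \<open>2 r x y \<le> r\<^sup>2 x\<^sup>2 + y\<^sup>2\<close> is integrated and then optimised over
  \<open>r\<close>.\<close>

lemma integral_Cauchy_Schwarz: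
  fixes f g :: "'a::euclidean_space \<Rightarrow> complex"
  assumes fg: "(\<lambda>x. f x * g x) integrable_on S"
    and f: "(\<lambda>x. (cmod (f x))\<^sup>2) integrable_on S" and g: "(\<lambda>x. (cmod (g x))\<^sup>2) integrable_on S"
  shows "(cmod (integral S (\<lambda>x. f x * g x)))\<^sup>2 \<le>
    integral S (\<lambda>x. (cmod (f x))\<^sup>2) * integral S (\<lambda>x. (cmod (g x))\<^sup>2)"
proof (rule square_le_mult_of_quadratic)
  let ?I = "integral S (\<lambda>x. f x * g x)"
  fix r :: real assume r: "0 < r"
  \<comment> \<open>\<open>z\<close> rotates the integral onto the nonnegative real axis; it is 0 if
    the integral is 0, hence only \<open>cmod z \<le> 1\<close>.\<close>
  define z where "z = cnj (sgn ?I)"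
  have z: "cmod z \<le> 1" by (simp add: z_def norm_sgn)
  have "?I * cnj ?I = of_real (cmod ?I) * of_real (cmod ?I)"
    using complex_norm_square[of ?I] by (simp add: power2_eq_square)
  then have "of_real (cmod ?I) = z * ?I"
    by (cases "?I = 0") (simp_all add: z_def sgn_eq mult.commute)
  then have "cmod ?I = Re (integral S (\<lambda>x. z * (f x * g x)))"
    by (simp add: complex_eq_iff)
  also have "\<dots> = integral S (\<lambda>x. Re (z * (f x * g x)))"
    using has_integral_Re[OF integrable_integral[OF integrable_on_mult_right[OF fg, of z]]]
    by (simp add: integral_unique)
  finally have I: "cmod ?I = integral S (\<lambda>x. Re (z * (f x * g x)))" .
  have "integral S (\<lambda>x. 2 * r * Re (z * (f x * g x))) \<le>
      integral S (\<lambda>x. r\<^sup>2 * (cmod (f x))\<^sup>2 + (cmod (g x))\<^sup>2)"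
  proof (rule integral_le)
    have "(\<lambda>x. Re (z * (f x * g x))) integrable_on S"
      using has_integral_Re[OF integrable_integral[OF integrable_on_mult_right[OF fg, of z]]] by blast
    from integrable_on_mult_right[OF this, of "2 * r"]
    show "(\<lambda>x. 2 * r * Re (z * (f x * g x))) integrable_on S" by simp
    show "(\<lambda>x. r\<^sup>2 * (cmod (f x))\<^sup>2 + (cmod (g x))\<^sup>2) integrable_on S"
      using integrable_add[OF integrable_on_mult_right[OF f, of "r\<^sup>2"] g] by simp
    fix x
    have "Re (z * (f x * g x)) \<le> cmod (z * (f x * g x))" by (rule complex_Re_le_cmod)
    also have "\<dots> \<le> 1 * (cmod (f x) * cmod (g x))"
      unfolding norm_mult using z by (intro mult_right_mono) auto
    finally have "2 * r * Re (z * (f x * g x)) \<le> 2 * r * (cmod (f x) * cmod (g x))"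
      using r by (intro mult_left_mono) auto
    also have "\<dots> \<le> r\<^sup>2 * (cmod (f x))\<^sup>2 + (cmod (g x))\<^sup>2"
      using sum_squares_bound[of "r * cmod (f x)" "cmod (g x)"] by (simp add: power_mult_distrib algebra_simps)
    finally show "2 * r * Re (z * (f x * g x)) \<le> r\<^sup>2 * (cmod (f x))\<^sup>2 + (cmod (g x))\<^sup>2" .
  qed
  also have "\<dots> = r\<^sup>2 * integral S (\<lambda>x. (cmod (f x))\<^sup>2) + integral S (\<lambda>x. (cmod (g x))\<^sup>2)"
    using Henstock_Kurzweil_Integration.integral_add[OF integrable_on_mult_right[OF f, of "r\<^sup>2"] g] by simp
  finally show "2 * cmod ?I * r \<le> r\<^sup>2 * integral S (\<lambda>x. (cmod (f x))\<^sup>2) + integral S (\<lambda>x. (cmod (g x))\<^sup>2)"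
    unfolding I by (simp add: mult.commute mult.left_commute)
qed (auto intro: integral_nonneg f g)

lemma cmod_integral_mult_le:
  fixes f g :: "real \<Rightarrow> complex"
  assumes "0 < a" "continuous_on {-a..a} f" "continuous_on {-a..a} g"
  shows "(cmod (integral {-a..a} (\<lambda>t. f t * g t)))\<^sup>2 \<le> sqnorm a f * sqnorm a g"
  unfolding sqnorm_def
  by (intro integral_Cauchy_Schwarz) (auto intro!: integrable_continuous_real continuous_intros assms)

lemma sqnorm_nonneg [simp]: "0 \<le> sqnorm a f"
  unfolding sqnorm_def
  \<comment> \<open>The gauge integral of a non-integrable function is 0 by convention, which
    settles the second case.\<close>
  by (cases "(\<lambda>t. (cmod (f t))\<^sup>2) integrable_on {-a..a}")
     (auto intro: Henstock_Kurzweil_Integration.integral_nonneg simp: not_integrable_integral)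

text \<open>\<open>exp (c * (t - u))\<close> is a product of a function of \<open>t\<close> and a
  function of \<open>u\<close>, so the form factors into two one-dimensional integrals. Each is
  integrated by parts and gains a factor of modulus \<open>\<bar>c\<bar>\<close>, and
  Cauchy--Schwarz bounds the remaining pairings \<open>P\<close> and \<open>Q\<close>.\<close>

lemma cmod_form_exp_deriv_le:
  assumes f: "vanishing_primitive a f f'" and a: "0 < a"
  shows "cmod (form a (\<lambda>x. exp (c * x)) f') \<le> c\<^sup>2 * (2 * a * exp (2 * \<bar>c\<bar> * a)) * sqnorm a f"
proof -
  have cf: "continuous_on {-a..a} f" "continuous_on {-a..a} f'"
    using f by (auto simp: vanishing_primitive_def)
  let ?e = "\<lambda>c t. complex_of_real (exp (c * t))"
  define P where "P = integral {-a..a} (\<lambda>u. ?e (-c) u * f u)"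
  define Q where "Q = integral {-a..a} (\<lambda>u. ?e c u * cnj (f u))"
  have "integral {-a..a} (\<lambda>u. ?e (-c) u * f' u) = - integral {-a..a} (\<lambda>u. (of_real (-c) * ?e (-c) u) * f u)"
    by (intro integral_deriv_mult_vanishing_primitive[OF f a] has_vector_derivative_of_real_exp)
       (auto intro!: continuous_intros simp del: of_real_exp)
  also have "\<dots> = of_real c * P"
    unfolding P_def by (simp add: mult.assoc)
  finally have P: "integral {-a..a} (\<lambda>u. ?e (-c) u * f' u) = of_real c * P" .
  have "conv a (\<lambda>x. exp (c * x)) f' t = of_real c * P * ?e c t" for t
  proof -
    have "conv a (\<lambda>x. exp (c * x)) f' t = integral {-a..a} (\<lambda>u. ?e c t * (?e (-c) u * f' u))"
      unfolding conv_def by (intro integral_cong)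
        (simp add: right_diff_distrib flip: exp_add of_real_exp of_real_mult mult.assoc)
    then show ?thesis
      using P by simp
  qed
  then have "form a (\<lambda>x. exp (c * x)) f' = of_real c * P * integral {-a..a} (\<lambda>t. ?e c t * cnj (f' t))"
    unfolding form_def by (simp add: mult.assoc)
  also have "integral {-a..a} (\<lambda>t. ?e c t * cnj (f' t)) = - integral {-a..a} (\<lambda>t. (of_real c * ?e c t) * cnj (f t))"
    by (intro integral_deriv_mult_vanishing_primitive[OF vanishing_primitive_cnj[OF f] a] has_vector_derivative_of_real_exp)
       (auto intro!: continuous_intros simp del: of_real_exp)
  also have "\<dots> = - of_real c * Q"
    unfolding Q_def by (simp add: mult.assoc)
  finally have "form a (\<lambda>x. exp (c * x)) f' = - of_real (c\<^sup>2) * (P * Q)"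
    by (simp add: power2_eq_square)
  then have eq: "cmod (form a (\<lambda>x. exp (c * x)) f') = c\<^sup>2 * (cmod P * cmod Q)"
    by (simp add: norm_mult norm_power)
  \<comment> \<open>Length of the interval times the maximum of
    \<open>exp (2 * \<bar>c\<bar> * \<bar>t\<bar>)\<close> on it.\<close>
  define M where "M = 2 * a * exp (2 * \<bar>c\<bar> * a)"
  have M0: "0 \<le> M" using a by (simp add: M_def)
  have e: "sqnorm a (?e d) \<le> M" if "\<bar>d\<bar> = \<bar>c\<bar>" for d
  proof -
    have "sqnorm a (?e d) \<le> integral {-a..a} (\<lambda>t. exp (2 * \<bar>c\<bar> * a))"
      unfolding sqnorm_def
    proof (rule integral_le)
      fix x assume "x \<in> {-a..a}"
      then have "\<bar>d\<bar> * \<bar>x\<bar> \<le> \<bar>c\<bar> * a"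
        using that by (intro mult_mono) auto
      then have "d * x \<le> \<bar>c\<bar> * a"
        using abs_ge_self[of "d * x"] by (simp add: abs_mult)
      then show "(cmod (?e d x))\<^sup>2 \<le> exp (2 * \<bar>c\<bar> * a)"
        by (simp flip: exp_double)
    qed (auto intro!: integrable_continuous_real continuous_intros)
    also have "\<dots> = M" using a by (simp add: M_def)
    finally show ?thesis .
  qed
  have "(cmod P)\<^sup>2 \<le> sqnorm a (?e (-c)) * sqnorm a f"
    unfolding P_def by (intro cmod_integral_mult_le a cf) (auto intro!: continuous_intros simp del: of_real_exp)
  also have "\<dots> \<le> M * sqnorm a f" by (intro mult_right_mono e) auto
  finally have P: "(cmod P)\<^sup>2 \<le> M * sqnorm a f" .
  have "(cmod Q)\<^sup>2 \<le> sqnorm a (?e c) * sqnorm a (\<lambda>t. cnj (f t))"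
    unfolding Q_def by (intro cmod_integral_mult_le a) (auto intro!: continuous_intros cf simp del: of_real_exp)
  also have "\<dots> \<le> M * sqnorm a f"
    by (rule mult_mono) (use a in \<open>auto intro: e simp: M0 sqnorm_def[of a "\<lambda>t. cnj (f t)"] sqnorm_def[of a f, symmetric]\<close>)
  finally have Q: "(cmod Q)\<^sup>2 \<le> M * sqnorm a f" .
  have "2 * (cmod P * cmod Q) \<le> (cmod P)\<^sup>2 + (cmod Q)\<^sup>2"
    using sum_squares_bound[of "cmod P" "cmod Q"] by (simp add: mult.assoc)
  with P Q have "cmod P * cmod Q \<le> M * sqnorm a f" by simp
  then have "c\<^sup>2 * (cmod P * cmod Q) \<le> c\<^sup>2 * (M * sqnorm a f)"
    by (intro mult_left_mono) auto
  then show ?thesis unfolding eq M_def by (simp add: mult.assoc)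
qed

subsection \<open>Primitives of functions orthogonal to low frequencies\<close>

lemma has_vector_derivative_cis:
  "((\<lambda>u. cis (c * u)) has_vector_derivative \<i> * of_real c * cis (c * t)) (at t within S)"
proof -
  have "((\<lambda>u. exp (\<i> * of_real c * u)) has_field_derivative \<i> * of_real c * exp (\<i> * of_real c * of_real t))
      (at (complex_of_real t))"
    by (auto intro!: derivative_eq_intros)
  from has_vector_derivative_real_field[OF this] show ?thesis
    by (simp add: cis_conv_exp mult_ac)
qed

section \<open>Exponentials of period \<open>2 * a\<close> and Bessel's inequality\<close>

definition fbasis :: "real \<Rightarrow> int \<Rightarrow> real \<Rightarrow> complex" where
  "fbasis a n u = cis (pi * of_int n * u / a)"

text \<open>The pairing of \<open>fbasis a n\<close> with the indicator of \<open>{-a..t}\<close>;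
  its conjugate divided by \<open>2 * a\<close> is the \<open>n\<close>-th Fourier coefficient of
  that indicator.\<close>

definition fcoeff :: "real \<Rightarrow> int \<Rightarrow> real \<Rightarrow> complex" where
  "fcoeff a n t = integral {-a..t} (fbasis a n)"

lemma continuous_on_fbasis [continuous_intros]: "continuous_on S (fbasis a n)"
  unfolding fbasis_def by (cases "a = 0") (auto intro!: continuous_intros)

lemma fbasis_mult_cnj: "fbasis a n u * cnj (fbasis a m u) = fbasis a (n - m) u"
  by (simp add: fbasis_def cis_cnj cis_mult diff_divide_distrib algebra_simps)

lemma has_integral_fbasis:
  assumes "0 < a" "n \<noteq> 0" "-a \<le> t"
  shows "(fbasis a n has_integral
    (fbasis a n t - fbasis a n (-a)) / (\<i> * of_real (pi * of_int n / a))) {-a..t}"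
proof -
  let ?c = "pi * of_int n / a"
  have d: "((\<lambda>u. fbasis a n u / (\<i> * of_real ?c)) has_vector_derivative fbasis a n u) (at u within {-a..t})" for u
  proof -
    have "((\<lambda>u. fbasis a n u) has_vector_derivative \<i> * of_real ?c * fbasis a n u) (at u within {-a..t})"
      using has_vector_derivative_cis[of ?c u] by (simp add: fbasis_def)
    from has_vector_derivative_divide[OF this, of "\<i> * of_real ?c"] show ?thesis
      using assms by simp
  qed
  show ?thesis
    unfolding diff_divide_distrib by (rule fundamental_theorem_of_calculus[OF assms(3) d])
qed

lemma fcoeff_0: "-a \<le> t \<Longrightarrow> fcoeff a 0 t = of_real (t + a)"
  by (simp add: fcoeff_def fbasis_def[abs_def] scaleR_conv_of_real)

lemma fcoeff_full: "0 < a \<Longrightarrow> fcoeff a n a = (if n = 0 then of_real (2 * a) else 0)"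
proof (cases "n = 0")
  case False
  assume a: "0 < a"
  have "fbasis a n a = fbasis a n (-a)"
    using a by (simp add: fbasis_def complex_eq_iff)
  with has_integral_fbasis[OF a False, of a] a False show ?thesis
    unfolding fcoeff_def by (simp add: integral_unique)
qed (simp add: fcoeff_0)

lemma cmod_fcoeff_sq:
  assumes "0 < a" "n \<noteq> 0" "-a \<le> t"
  shows "(cmod (fcoeff a n t))\<^sup>2 = 2 * a\<^sup>2 / (pi\<^sup>2 * (of_int n)\<^sup>2) * (1 - cos (pi * of_int n * (t + a) / a))"
proof -
  have "(cmod (fbasis a n t - fbasis a n (-a)))\<^sup>2 = 2 - 2 * cos (pi * of_int n * t / a - pi * of_int n * (-a) / a)"
    unfolding fbasis_def cos_diff
    by (simp add: cmod_power2 power2_diff)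
  also have "pi * of_int n * t / a - pi * of_int n * (-a) / a = pi * of_int n * (t + a) / a"
    by (simp add: algebra_simps add_divide_distrib)
  finally have X: "(cmod (fbasis a n t - fbasis a n (-a)))\<^sup>2 = 2 - 2 * cos (pi * of_int n * (t + a) / a)" .
  have "(cmod (fcoeff a n t))\<^sup>2 = (cmod (fbasis a n t - fbasis a n (-a)))\<^sup>2 / (pi * of_int n / a)\<^sup>2"
    unfolding fcoeff_def integral_unique[OF has_integral_fbasis[OF assms]] norm_divide norm_mult norm_of_real
    by (simp add: power_divide power_mult_distrib)
  then show ?thesis
    unfolding X using assms by (simp add: power_divide power_mult_distrib field_simps)
qed

text \<open>By \<open>cmod_fcoeff_sq\<close> the integrand for \<open>n \<noteq> 0\<close> is a
  constant times one minus a cosine, and the cosine runs through whole periods over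
  \<open>{-a..a}\<close>.\<close>

lemma has_integral_cmod_fcoeff_sq:
  assumes a: "0 < a"
  shows "((\<lambda>t. (cmod (fcoeff a n t))\<^sup>2) has_integral
     (if n = 0 then 8 * a^3 / 3 else 4 * a^3 / (pi\<^sup>2 * (of_int n)\<^sup>2))) {-a..a}"
proof (cases "n = 0")
  case True
  have "((\<lambda>t. (t + a)\<^sup>2) has_integral ((a + a)^3 / 3 - (- a + a)^3 / 3)) {-a..a}"
    by (rule fundamental_theorem_of_calculus)
       (use a in \<open>auto intro!: derivative_eq_intros simp flip: has_real_derivative_iff_has_vector_derivative\<close>)
  then have "((\<lambda>t. (cmod (fcoeff a n t))\<^sup>2) has_integral ((a + a)^3 / 3 - (- a + a)^3 / 3)) {-a..a}"
    by (rule has_integral_eq[rotated]) (simp only: True fcoeff_0 atLeastAtMost_iff norm_of_real power2_abs)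
  also have "(a + a)^3 / 3 - (- a + a)^3 / 3 = 8 * a^3 / 3" by (simp add: power3_eq_cube)
  finally show ?thesis using True by simp
next
  case False
  let ?c = "pi * of_int n / a"
  let ?F = "\<lambda>t. 2 * a\<^sup>2 / (pi\<^sup>2 * (of_int n)\<^sup>2) * (t - sin (?c * (t + a)) / ?c)"
  have "((\<lambda>t. 2 * a\<^sup>2 / (pi\<^sup>2 * (of_int n)\<^sup>2) * (1 - cos (?c * (t + a)))) has_integral (?F a - ?F (-a))) {-a..a}"
    by (rule fundamental_theorem_of_calculus)
       (use a False in \<open>auto intro!: derivative_eq_intros simp flip: has_real_derivative_iff_has_vector_derivative\<close>)
  then have "((\<lambda>t. (cmod (fcoeff a n t))\<^sup>2) has_integral (?F a - ?F (-a))) {-a..a}"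
    by (rule has_integral_eq[rotated]) (use a False in \<open>auto simp: cmod_fcoeff_sq\<close>)
  also have "sin (?c * (a + a)) = 0"
  proof -
    have "?c * (a + a) = of_int (2 * n) * pi" using a by simp
    then show ?thesis unfolding sin_zero_iff_int2 by blast
  qed
  then have "?F a - ?F (-a) = 4 * a^3 / (pi\<^sup>2 * (of_int n)\<^sup>2)"
    by (simp add: power3_eq_cube power2_eq_square)
  finally show ?thesis using False by simp
qed

text \<open>Parseval for trigonometric polynomials: the double sum collapses to its diagonal because
  \<open>fcoeff a (n - m) a = 0\<close> for \<open>n \<noteq> m\<close>.\<close>

lemma has_integral_trig_poly_sq:
  assumes a: "0 < a" and J: "finite J"
  shows "((\<lambda>u. (\<Sum>n\<in>J. c n * fbasis a n u) * cnj (\<Sum>n\<in>J. c n * fbasis a n u)) has_integral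
      of_real (2 * a) * (\<Sum>n\<in>J. c n * cnj (c n))) {-a..a}"
proof -
  have "(fbasis a n has_integral fcoeff a n a) {-a..a}" for n
    unfolding fcoeff_def by (intro integrable_integral integrable_continuous_real continuous_intros)
  then have "((\<lambda>u. \<Sum>n\<in>J. \<Sum>m\<in>J. c n * cnj (c m) * fbasis a (n - m) u) has_integral
      (\<Sum>n\<in>J. \<Sum>m\<in>J. c n * cnj (c m) * fcoeff a (n - m) a)) {-a..a}"
    by (intro has_integral_sum J has_integral_mult_right)
  moreover have "(\<Sum>n\<in>J. \<Sum>m\<in>J. c n * cnj (c m) * fbasis a (n - m) u) =
      (\<Sum>n\<in>J. c n * fbasis a n u) * cnj (\<Sum>n\<in>J. c n * fbasis a n u)" for u
    unfolding cnj_sum sum_product fbasis_mult_cnj[symmetric] by (simp add: mult_ac)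
  moreover have "(\<Sum>n\<in>J. \<Sum>m\<in>J. c n * cnj (c m) * fcoeff a (n - m) a) = of_real (2 * a) * (\<Sum>n\<in>J. c n * cnj (c n))"
    unfolding sum_distrib_left
  proof (rule sum.cong[OF refl])
    fix n assume n: "n \<in> J"
    have "(\<Sum>m\<in>J. c n * cnj (c m) * fcoeff a (n - m) a) = (\<Sum>m\<in>J. if m = n then c n * cnj (c n) * of_real (2 * a) else 0)"
      by (intro sum.cong) (auto simp: fcoeff_full[OF a])
    also have "\<dots> = of_real (2 * a) * (c n * cnj (c n))" using n J by simp
    finally show "(\<Sum>m\<in>J. c n * cnj (c m) * fcoeff a (n - m) a) = of_real (2 * a) * (c n * cnj (c n))" .
  qed
  ultimately show ?thesis by simp
qed

text \<open>Pair \<open>\<psi>\<close> with \<open>q\<close>, whose coefficients are the conjugates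
  of the integrals \<open>b n\<close>: the pairing is \<open>S\<close> and the squared norm of
  \<open>q\<close> is \<open>2 * a * S\<close>, so Cauchy--Schwarz yields
  \<open>S\<^sup>2 \<le> 2 * a * S * sqnorm a \<psi>\<close> and one factor \<open>S\<close>
  cancels.\<close>

lemma fourier_Bessel:
  assumes a: "0 < a" and \<psi>: "continuous_on {-a..a} \<psi>" and J: "finite J"
  shows "(\<Sum>n\<in>J. (cmod (integral {-a..a} (\<lambda>u. fbasis a n u * \<psi> u)))\<^sup>2) \<le> 2 * a * sqnorm a \<psi>"
proof -
  define b where "b n = integral {-a..a} (\<lambda>u. fbasis a n u * \<psi> u)" for n
  define q where "q u = (\<Sum>n\<in>J. cnj (b n) * fbasis a n u)" for u
  define S where "S = (\<Sum>n\<in>J. (cmod (b n))\<^sup>2)"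
  have S: "of_real S = (\<Sum>n\<in>J. b n * cnj (b n))"
    unfolding S_def of_real_sum complex_norm_square ..
  have "((\<lambda>u. \<Sum>n\<in>J. cnj (b n) * (fbasis a n u * \<psi> u)) has_integral (\<Sum>n\<in>J. cnj (b n) * b n)) {-a..a}"
    unfolding b_def
    by (intro has_integral_sum J has_integral_mult_right integrable_integral integrable_continuous_real continuous_intros \<psi>)
  then have q\<psi>: "((\<lambda>u. q u * \<psi> u) has_integral of_real S) {-a..a}"
    unfolding S q_def sum_distrib_right by (simp add: mult_ac)
  have "((\<lambda>u. of_real ((cmod (q u))\<^sup>2)) has_integral complex_of_real (2 * a * S)) {-a..a}"
    using has_integral_trig_poly_sq[OF a J, of "\<lambda>n. cnj (b n)"]
    unfolding complex_norm_square of_real_mult[of "2 * a"] S by (simp add: q_def mult.commute)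
  from has_integral_Re[OF this] have qq: "((\<lambda>u. (cmod (q u))\<^sup>2) has_integral (2 * a * S)) {-a..a}" by simp
  have "(cmod (integral {-a..a} (\<lambda>u. q u * \<psi> u)))\<^sup>2 \<le>
      integral {-a..a} (\<lambda>u. (cmod (q u))\<^sup>2) * integral {-a..a} (\<lambda>u. (cmod (\<psi> u))\<^sup>2)"
  proof (rule integral_Cauchy_Schwarz)
    show "(\<lambda>u. (cmod (\<psi> u))\<^sup>2) integrable_on {-a..a}"
      by (intro integrable_continuous_real continuous_intros \<psi>)
  qed (use q\<psi> qq in blast)+
  then have "S * S \<le> S * (2 * a * sqnorm a \<psi>)"
    unfolding integral_unique[OF q\<psi>] integral_unique[OF qq] sqnorm_def by (simp add: power2_eq_square mult_ac)
  moreover have "0 \<le> S" unfolding S_def by (intro sum_nonneg) simp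
  ultimately have "S \<le> 2 * a * sqnorm a \<psi>"
    using a by (cases "S = 0") auto
  then show ?thesis by (simp add: S_def b_def)
qed

text \<open>The integral of \<open>\<psi>\<close> over \<open>{-a..t}\<close> is its pairing with an
  indicator, from which orthogonality allows subtracting any \<open>p\<close> in the span of the
  given frequencies. Cauchy--Schwarz is sharpest when \<open>p\<close> is the orthogonal projection
  of the indicator.\<close>

lemma cmod_indefinite_integral_sq_le:
  assumes a: "0 < a" and \<psi>: "continuous_on {-a..a} \<psi>" and t: "t \<in> {-a..a}" and "finite J"
    and orth: "\<And>n. n \<in> J \<Longrightarrow> integral {-a..a} (\<lambda>x. \<psi> x * fbasis a n x) = 0"
  shows "(cmod (integral {-a..t} \<psi>))\<^sup>2 \<le>
    ((t + a) - (\<Sum>n\<in>J. (cmod (fcoeff a n t))\<^sup>2) / (2 * a)) * sqnorm a \<psi>"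
proof -
  let ?\<chi> = "\<lambda>u. if u \<in> {-a..t} then 1 else 0 :: complex"
  \<comment> \<open>Coefficients of the orthogonal projection \<open>p\<close>; \<open>s\<close> is
    the squared norm of \<open>p\<close> and also the integral of \<open>p\<close> over
    \<open>{-a..t}\<close>.\<close>
  define c where "c n = cnj (fcoeff a n t) / of_real (2 * a)" for n
  define p where "p u = (\<Sum>n\<in>J. c n * fbasis a n u)" for u
  define s where "s = (\<Sum>n\<in>J. (cmod (fcoeff a n t))\<^sup>2) / (2 * a)"
  have cp: "continuous_on S p" for S
    unfolding p_def by (intro continuous_intros)
  have sub: "{-a..t} \<subseteq> {-a..a}" using t by auto
  have \<chi>: "((\<lambda>u. ?\<chi> u * h u) has_integral integral {-a..t} h) {-a..a}" if "continuous_on {-a..a} h" for h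
  proof -
    have "(h has_integral integral {-a..t} h) {-a..t}"
      using that sub by (intro integrable_integral integrable_continuous_real) (rule continuous_on_subset)
    then have "((\<lambda>u. if u \<in> {-a..t} then h u else 0) has_integral integral {-a..t} h) {-a..a}"
      using has_integral_restrict[OF sub] by blast
    then show ?thesis by (rule has_integral_eq[rotated]) auto
  qed
  have fint: "(fbasis a n has_integral fcoeff a n x) {-a..x}" if "x \<in> {-a..a}" for n x
    unfolding fcoeff_def by (intro integrable_integral integrable_continuous_real continuous_intros)
  have s1: "(\<Sum>n\<in>J. c n * fcoeff a n t) = of_real s"
    unfolding s_def c_def of_real_divide of_real_sum complex_norm_square sum_divide_distrib
    by (simp add: mult.commute)
  have "integral {-a..t} p = (\<Sum>n\<in>J. c n * fcoeff a n t)"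
    unfolding p_def by (intro integral_unique has_integral_sum assms has_integral_mult_right fint t)
  with s1 have ip: "integral {-a..t} p = of_real s" by simp
  have ip': "integral {-a..t} (\<lambda>u. cnj (p u)) = of_real s"
    using ip by (simp flip: integral_cnj)
  have "(\<Sum>n\<in>J. c n * fcoeff a n t) = of_real (2 * a) * (\<Sum>n\<in>J. c n * cnj (c n))"
    unfolding sum_distrib_left using a by (intro sum.cong) (simp_all add: c_def)
  with s1 has_integral_trig_poly_sq[OF a \<open>finite J\<close>, of c]
  have pp: "((\<lambda>u. p u * cnj (p u)) has_integral of_real s) {-a..a}"
    by (simp only: p_def)
  \<comment> \<open>Pythagoras: expanding the squared distance between the indicator and its
    projection leaves \<open>t + a - s\<close>.\<close>
  have "((\<lambda>u. ?\<chi> u * 1 - ?\<chi> u * p u - ?\<chi> u * cnj (p u) + p u * cnj (p u)) has_integral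
      (integral {-a..t} (\<lambda>u. 1) - of_real s - of_real s + of_real s)) {-a..a}"
    using \<chi>[OF continuous_on_const, of 1] \<chi>[OF cp] \<chi>[OF continuous_on_cnj[OF cp]]
    unfolding ip ip' by (intro has_integral_add has_integral_diff pp)
  moreover have "?\<chi> u * 1 - ?\<chi> u * p u - ?\<chi> u * cnj (p u) + p u * cnj (p u) = of_real ((cmod (?\<chi> u - p u))\<^sup>2)" for u
    unfolding complex_norm_square by (cases "u \<in> {-a..t}") (simp_all add: algebra_simps del: atLeastAtMost_iff)
  ultimately have "((\<lambda>u. of_real ((cmod (?\<chi> u - p u))\<^sup>2)) has_integral complex_of_real (t + a - s)) {-a..a}"
    using t by (simp add: scaleR_conv_of_real algebra_simps del: of_real_power)
  from has_integral_Re[OF this]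
  have sq: "((\<lambda>u. (cmod (?\<chi> u - p u))\<^sup>2) has_integral (t + a - s)) {-a..a}" by simp
  have "((\<lambda>u. \<Sum>n\<in>J. c n * (\<psi> u * fbasis a n u)) has_integral (\<Sum>n\<in>J. c n * integral {-a..a} (\<lambda>x. \<psi> x * fbasis a n x))) {-a..a}"
    by (intro has_integral_sum assms has_integral_mult_right integrable_integral integrable_continuous_real continuous_intros)
  moreover have "(\<Sum>n\<in>J. c n * (\<psi> u * fbasis a n u)) = p u * \<psi> u" for u
    unfolding p_def sum_distrib_right by (simp add: mult_ac)
  ultimately have "((\<lambda>u. p u * \<psi> u) has_integral 0) {-a..a}"
    by (simp add: orth)
  from has_integral_diff[OF \<chi>[OF \<psi>] this]
  have F: "((\<lambda>u. (?\<chi> u - p u) * \<psi> u) has_integral integral {-a..t} \<psi>) {-a..a}"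
    by (simp only: left_diff_distrib diff_0_right)
  have "(cmod (integral {-a..a} (\<lambda>u. (?\<chi> u - p u) * \<psi> u)))\<^sup>2 \<le>
      integral {-a..a} (\<lambda>u. (cmod (?\<chi> u - p u))\<^sup>2) * integral {-a..a} (\<lambda>u. (cmod (\<psi> u))\<^sup>2)"
  proof (rule integral_Cauchy_Schwarz)
    show "(\<lambda>u. (?\<chi> u - p u) * \<psi> u) integrable_on {-a..a}" using F by blast
    show "(\<lambda>u. (cmod (?\<chi> u - p u))\<^sup>2) integrable_on {-a..a}" using sq by blast
    show "(\<lambda>u. (cmod (\<psi> u))\<^sup>2) integrable_on {-a..a}"
      by (intro integrable_continuous_real continuous_intros \<psi>)
  qed
  then show ?thesis
    unfolding integral_unique[OF F] integral_unique[OF sq] s_def sqnorm_def .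
qed

text \<open>\<open>a\<^sup>2\<close> times this is the integral over \<open>t\<close> of the squared \<open>L\<^sup>2\<close> distance from the indicator of
  \<open>{-a..t}\<close> to the trigonometric polynomials of degree \<open>N\<close>.\<close>

definition basel_defect :: "nat \<Rightarrow> real" where
  "basel_defect N = 2 / 3 - 4 / pi\<^sup>2 * (\<Sum>n<N. 1 / (real n + 1)\<^sup>2)"

text \<open>The Basel sum \<open>pi\<^sup>2 / 6\<close> makes the subtracted term tend to
  \<open>2 / 3\<close>.\<close>

lemma basel_defect_tendsto_0: "basel_defect \<longlonglongrightarrow> 0"
proof -
  have "(\<lambda>N. 2 / 3 - 4 / pi\<^sup>2 * (\<Sum>n<N. 1 / (real n + 1)\<^sup>2)) \<longlonglongrightarrow> 2 / 3 - 4 / pi\<^sup>2 * (pi\<^sup>2 / 6)"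
    using inverse_squares_sums unfolding sums_def by (intro tendsto_intros) (simp add: add.commute)
  then show ?thesis by (simp add: basel_defect_def[abs_def])
qed

lemma sum_symmetric_int_interval:
  fixes f :: "int \<Rightarrow> real"
  assumes "\<And>n. f (-n) = f n"
  shows "(\<Sum>n\<in>{-int N..int N}. f n) = f 0 + 2 * (\<Sum>n<N. f (int n + 1))"
proof (induction N)
  case (Suc N)
  have "{-int (Suc N)..int (Suc N)} = insert (- (int N + 1)) (insert (int N + 1) {-int N..int N})"
    by auto
  then show ?case using Suc assms[of "int N + 1"] by simp
qed simp

text \<open>The pointwise bound is integrated over \<open>t\<close>. Frequency 0 and the pairs
  \<open>n\<close>, \<open>-n\<close> reduce the main term \<open>2 * a\<^sup>2\<close> to
  \<open>a\<^sup>2 * basel_defect N\<close>.\<close>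

lemma sqnorm_indefinite_integral_le:
  assumes a: "0 < a" and \<psi>: "continuous_on {-a..a} \<psi>"
    and orth: "\<And>n. \<bar>n\<bar> \<le> int N \<Longrightarrow> integral {-a..a} (\<lambda>x. \<psi> x * fbasis a n x) = 0"
  shows "sqnorm a (\<lambda>t. integral {-a..t} \<psi>) \<le> a\<^sup>2 * basel_defect N * sqnorm a \<psi>"
proof -
  let ?J = "{-int N..int N}"
  define w where "w n = (if n = 0 then 8 * a^3 / 3 else 4 * a^3 / (pi\<^sup>2 * (of_int n)\<^sup>2))" for n :: int
  have "((\<lambda>t. t + a) has_integral ((a + a)\<^sup>2 / 2 - (- a + a)\<^sup>2 / 2)) {-a..a}"
    by (rule fundamental_theorem_of_calculus)
       (use a in \<open>auto intro!: derivative_eq_intros simp flip: has_real_derivative_iff_has_vector_derivative\<close>)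
  then have "((\<lambda>t. (t + a) - (\<Sum>n\<in>?J. (cmod (fcoeff a n t))\<^sup>2) / (2 * a)) has_integral
      ((a + a)\<^sup>2 / 2 - (- a + a)\<^sup>2 / 2 - (\<Sum>n\<in>?J. w n) / (2 * a))) {-a..a}"
    unfolding w_def by (intro has_integral_diff has_integral_divide has_integral_sum has_integral_cmod_fcoeff_sq a) auto
  from has_integral_mult_left[OF this, of "sqnorm a \<psi>"]
  have E: "((\<lambda>t. ((t + a) - (\<Sum>n\<in>?J. (cmod (fcoeff a n t))\<^sup>2) / (2 * a)) * sqnorm a \<psi>) has_integral
      ((a + a)\<^sup>2 / 2 - (- a + a)\<^sup>2 / 2 - (\<Sum>n\<in>?J. w n) / (2 * a)) * sqnorm a \<psi>) {-a..a}" .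
  have "sqnorm a (\<lambda>t. integral {-a..t} \<psi>) \<le>
      ((a + a)\<^sup>2 / 2 - (- a + a)\<^sup>2 / 2 - (\<Sum>n\<in>?J. w n) / (2 * a)) * sqnorm a \<psi>"
    unfolding integral_unique[OF E, symmetric] sqnorm_def[of a "\<lambda>t. integral {-a..t} \<psi>"]
  proof (rule integral_le)
    show "(\<lambda>t. (cmod (integral {-a..t} \<psi>))\<^sup>2) integrable_on {-a..a}"
      by (intro integrable_continuous_real continuous_intros indefinite_integral_continuous_1 \<psi>)
    show "(\<lambda>t. ((t + a) - (\<Sum>n\<in>?J. (cmod (fcoeff a n t))\<^sup>2) / (2 * a)) * sqnorm a \<psi>) integrable_on {-a..a}"
      using E by blast
  qed (intro cmod_indefinite_integral_sq_le a \<psi> orth; auto)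
  also have "(\<Sum>n\<in>?J. w n) = 8 * a^3 / 3 + 2 * (\<Sum>n<N. 4 * a^3 / (pi\<^sup>2 * (real n + 1)\<^sup>2))"
  proof -
    have "w (int n + 1) = 4 * a^3 / (pi\<^sup>2 * (real n + 1)\<^sup>2)" for n
      by (simp add: w_def)
    then show ?thesis
      using sum_symmetric_int_interval[of w N] by (simp add: w_def[of 0] w_def[of "- _"] w_def[of _])
  qed
  also have "(\<Sum>n<N. 4 * a^3 / (pi\<^sup>2 * (real n + 1)\<^sup>2)) = 4 * a^3 / pi\<^sup>2 * (\<Sum>n<N. 1 / (real n + 1)\<^sup>2)"
    by (simp add: sum_distrib_left)
  also have "(a + a)\<^sup>2 / 2 - (- a + a)\<^sup>2 / 2 - (8 * a ^ 3 / 3 + 2 * (4 * a^3 / pi\<^sup>2 * (\<Sum>n<N. 1 / (real n + 1)\<^sup>2))) / (2 * a)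
      = a\<^sup>2 * basel_defect N"
    using a by (simp add: basel_defect_def field_simps power2_eq_square power3_eq_cube)
  finally show ?thesis .
qed

subsection \<open>The kernels \<open>\<bar>x - l\<bar>\<close>\<close>

text \<open>The nearest-point map onto \<open>{-a..a}\<close>. If \<open>f\<close> vanishes at both
  ends, \<open>f (clamp_to a s)\<close> is the continuous extension of \<open>f\<close> by zero, and
  the integral of \<open>f\<close> up to \<open>clamp_to a s\<close> is a primitive of that
  extension.\<close>

definition clamp_to :: "real \<Rightarrow> real \<Rightarrow> real" where
  "clamp_to a s = max (-a) (min a s)"

lemma continuous_on_clamp_to [continuous_intros]:
  "continuous_on S f \<Longrightarrow> continuous_on S (\<lambda>x. clamp_to a (f x))"
  unfolding clamp_to_def by (intro continuous_intros)

lemma clamp_to_mem: "0 < a \<Longrightarrow> clamp_to a s \<in> {-a..a}"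
  by (auto simp: clamp_to_def)

lemma integral_linear_mult_deriv:
  assumes f: "vanishing_primitive a f f'" and "-a \<le> c" "c \<le> d" "d \<le> a"
  shows "integral {c..d} (\<lambda>u. of_real (s - u) * f' u) =
    of_real (s - d) * f d - of_real (s - c) * f c + integral {c..d} f"
proof -
  have sub: "{c..d} \<subseteq> {-a..a}" using assms by auto
  have "((\<lambda>u. complex_of_real (s - u)) has_vector_derivative (- 1)) (at x)" for x
  proof -
    have "((\<lambda>u. s - u) has_real_derivative - 1) (at x)" by (auto intro!: derivative_eq_intros)
    from has_vector_derivative_of_real[OF this] show ?thesis by simp
  qed
  then have "integral {c..d} (\<lambda>u. of_real (s - u) * f' u) =
    of_real (s - d) * f d - of_real (s - c) * f c - integral {c..d} (\<lambda>u. (-1) * f u)"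
    using f assms(2-) unfolding vanishing_primitive_def
    by (intro integral_by_parts_complex) (auto intro!: continuous_intros intro: continuous_on_subset[OF _ sub])
  then show ?thesis by simp
qed

text \<open>The derivative of \<open>\<bar>s - u\<bar>\<close> in \<open>u\<close> is minus the sign
  of \<open>s - u\<close>, so integration by parts leaves the integral of \<open>f\<close> to the
  left of \<open>s\<close> minus the one to the right. Clamping covers the \<open>s\<close> outside
  the interval.\<close>

lemma integral_abs_diff_mult_deriv:
  assumes f: "vanishing_primitive a f f'" and a: "0 < a"
  shows "integral {-a..a} (\<lambda>u. of_real \<bar>s - u\<bar> * f' u) =
    2 * integral {-a..clamp_to a s} f - integral {-a..a} f"
proof -
  have cf: "continuous_on {-a..a} f" "continuous_on {-a..a} f'" "f (-a) = 0" "f a = 0"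
    using f by (auto simp: vanishing_primitive_def)
  consider "s < -a" | "s \<in> {-a..a}" | "a < s" by fastforce
  then show ?thesis
  proof cases
    case 1
    have "integral {-a..a} (\<lambda>u. of_real \<bar>s - u\<bar> * f' u) = integral {-a..a} (\<lambda>u. - (of_real (s - u) * f' u))"
      by (intro integral_cong) (use 1 in \<open>auto simp: algebra_simps\<close>)
    also have "\<dots> = - integral {-a..a} f"
      using integral_linear_mult_deriv[OF f, of "-a" a s] a cf by simp
    also have "clamp_to a s = -a" using 1 a by (simp add: clamp_to_def)
    then have "- integral {-a..a} f = 2 * integral {-a..clamp_to a s} f - integral {-a..a} f" by simp
    finally show ?thesis .
  next
    case 2
    let ?g = "\<lambda>u. of_real \<bar>s - u\<bar> * f' u"
    have "integral {-a..a} ?g = integral {-a..s} ?g + integral {s..a} ?g"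
      using 2 by (intro Henstock_Kurzweil_Integration.integral_combine[symmetric])
        (auto intro!: integrable_continuous_real continuous_intros cf)
    also have "integral {-a..s} ?g = integral {-a..s} (\<lambda>u. of_real (s - u) * f' u)"
      by (intro integral_cong) auto
    also have "\<dots> = integral {-a..s} f"
      using integral_linear_mult_deriv[OF f, of "-a" s s] 2 cf by simp
    also have "integral {s..a} ?g = integral {s..a} (\<lambda>u. - (of_real (s - u) * f' u))"
      by (intro integral_cong) (auto simp: algebra_simps)
    also have "\<dots> = - integral {s..a} f"
      using integral_linear_mult_deriv[OF f, of s a s] 2 cf by simp
    also have "integral {s..a} f = integral {-a..a} f - integral {-a..s} f"
      using Henstock_Kurzweil_Integration.integral_combine[of "-a" s a f] 2
      by (simp add: integrable_continuous_real cf algebra_simps)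
    also have "clamp_to a s = s" using 2 by (simp add: clamp_to_def)
    then have "integral {-a..s} f + - (integral {-a..a} f - integral {-a..s} f) =
        2 * integral {-a..clamp_to a s} f - integral {-a..a} f" by simp
    finally show ?thesis .
  next
    case 3
    have "integral {-a..a} (\<lambda>u. of_real \<bar>s - u\<bar> * f' u) = integral {-a..a} (\<lambda>u. of_real (s - u) * f' u)"
      by (intro integral_cong) (use 3 in auto)
    also have "\<dots> = integral {-a..a} f"
      using integral_linear_mult_deriv[OF f, of "-a" a s] a cf by simp
    also have "clamp_to a s = a" using 3 a by (simp add: clamp_to_def)
    then have "integral {-a..a} f = 2 * integral {-a..clamp_to a s} f - integral {-a..a} f" by simp
    finally show ?thesis .
  qed
qed

text \<open>Outside the interval the integral is locally constant and
  \<open>f (clamp_to a s)\<close> is an end value, hence 0.\<close>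

lemma has_vector_derivative_integral_clamp_to:
  assumes f: "continuous_on {-a..a} f" "f (-a) = 0" "f a = (0::complex)" and a: "0 < a" and s: "s \<noteq> -a" "s \<noteq> a"
  shows "((\<lambda>s. integral {-a..clamp_to a s} f) has_vector_derivative f (clamp_to a s)) (at s)"
proof -
  consider "s < -a" | "s \<in> {-a<..<a}" | "a < s" using s by fastforce
  then show ?thesis
  proof cases
    case 1
    have "((\<lambda>s. integral {-a..-a} f) has_vector_derivative 0) (at s)"
      by (rule has_vector_derivative_const)
    then have "((\<lambda>s. integral {-a..clamp_to a s} f) has_vector_derivative 0) (at s)"
      by (rule has_vector_derivative_transform_within_open[where S="{..<-a}"]) (use 1 a in \<open>auto simp: clamp_to_def\<close>)
    with 1 a f show ?thesis by (simp add: clamp_to_def)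
  next
    case 2
    have "((\<lambda>s. integral {-a..s} f) has_vector_derivative f s) (at s)"
      by (rule has_vector_derivative_integral_interior[OF f(1) 2])
    then have "((\<lambda>s. integral {-a..clamp_to a s} f) has_vector_derivative f s) (at s)"
      by (rule has_vector_derivative_transform_within_open[where S="{-a<..<a}"]) (use 2 in \<open>auto simp: clamp_to_def\<close>)
    with 2 show ?thesis by (simp add: clamp_to_def)
  next
    case 3
    have "((\<lambda>s. integral {-a..a} f) has_vector_derivative 0) (at s)"
      by (rule has_vector_derivative_const)
    then have "((\<lambda>s. integral {-a..clamp_to a s} f) has_vector_derivative 0) (at s)"
      by (rule has_vector_derivative_transform_within_open[where S="{a<..}"]) (use 3 a in \<open>auto simp: clamp_to_def\<close>)
    with 3 a f show ?thesis by (simp add: clamp_to_def)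
  qed
qed

text \<open>The clamped function is the extension of \<open>f\<close> by zero, so after a
  translation the window \<open>{-a..a}\<close> sees at most its full mass.\<close>

lemma sqnorm_shift_le:
  assumes f: "continuous_on {-a..a} f" "f (-a) = 0" "f a = (0::complex)" and a: "0 < a"
  shows "sqnorm a (\<lambda>t. f (clamp_to a (t - l))) \<le> sqnorm a f"
proof -
  let ?h = "\<lambda>s. (cmod (f (clamp_to a s)))\<^sup>2"
  have ch: "continuous_on S ?h" for S
    by (intro continuous_intros continuous_on_compose2[OF f(1)] image_subsetI clamp_to_mem[OF a])
  have "((\<lambda>s. (cmod (f s))\<^sup>2) has_integral sqnorm a f) {-a..a}"
    unfolding sqnorm_def by (intro integrable_integral integrable_continuous_real continuous_intros f)
  then have "(?h has_integral sqnorm a f) {-a..a}"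
    by (rule has_integral_eq[rotated]) (auto simp: clamp_to_def)
  then have hU: "(?h has_integral sqnorm a f) UNIV"
    by (rule has_integral_on_superset) (use f a in \<open>auto simp: clamp_to_def max_def min_def\<close>)
  have "sqnorm a (\<lambda>t. f (clamp_to a (t - l))) = integral {-a..a} (\<lambda>t. ?h (t - l))"
    by (simp add: sqnorm_def)
  also have "\<dots> = integral {-a - l..a - l} ?h"
  proof -
    have "(?h has_integral integral {-a - l..a - l} ?h) {-a - l..a - l}"
      by (intro integrable_integral integrable_continuous_real ch)
    from has_integral_affinity'[of ?h _ "-a - l" "a - l" 1 "-l"] this
    have "((\<lambda>t. ?h (t - l)) has_integral integral {-a - l..a - l} ?h) {-a..a}"
      by simp
    then show ?thesis by (rule integral_unique)
  qed
  also have "\<dots> \<le> integral UNIV ?h"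
    using hU by (intro integral_subset_le integrable_continuous_real ch) auto
  also have "\<dots> = sqnorm a f" using hU by (rule integral_unique)
  finally show ?thesis .
qed

text \<open>The second derivative of \<open>\<bar>x - l\<bar>\<close> is twice the point mass at
  \<open>l\<close>, so the form is minus twice the pairing of \<open>f\<close> with its translate by
  \<open>l\<close>. Cauchy--Schwarz then makes the bound independent of \<open>l\<close>.\<close>

lemma cmod_form_abs_shift_deriv_le:
  assumes f: "vanishing_primitive a f f'" and a: "0 < a"
  shows "cmod (form a (\<lambda>x. \<bar>x - l\<bar>) f') \<le> 2 * sqnorm a f"
proof -
  have cf: "continuous_on {-a..a} f" "f (-a) = 0" "f a = 0"
    using f by (auto simp: vanishing_primitive_def)
  let ?D = "\<lambda>t. f (clamp_to a (t - l))"
  have cD: "continuous_on {-a..a} ?D"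
    by (intro continuous_on_compose2[OF cf(1)] continuous_intros image_subsetI clamp_to_mem[OF a])
  have conv: "conv a (\<lambda>x. \<bar>x - l\<bar>) f' = (\<lambda>t. 2 * integral {-a..clamp_to a (t - l)} f - integral {-a..a} f)"
  proof
    fix t
    have "conv a (\<lambda>x. \<bar>x - l\<bar>) f' t = integral {-a..a} (\<lambda>u. of_real \<bar>(t - l) - u\<bar> * f' u)"
      unfolding conv_def by (simp add: algebra_simps)
    then show "conv a (\<lambda>x. \<bar>x - l\<bar>) f' t = 2 * integral {-a..clamp_to a (t - l)} f - integral {-a..a} f"
      using integral_abs_diff_mult_deriv[OF f a] by simp
  qed
  have "form a (\<lambda>x. \<bar>x - l\<bar>) f' = - integral {-a..a} (\<lambda>t. 2 * ?D t * cnj (f t))"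
  \<comment> \<open>The exceptional points are those where \<open>t - l\<close> meets an end of
    \<open>{-a..a}\<close>.\<close>
  proof (rule form_vanishing_primitive[OF f a, where S="{l - a, l + a}"])
    fix t assume "t \<in> {-a<..<a} - {l - a, l + a}"
    then have "((\<lambda>s. integral {-a..clamp_to a s} f) has_vector_derivative ?D t) (at (t - l))"
      by (intro has_vector_derivative_integral_clamp_to cf a) auto
    then have "((\<lambda>s. integral {-a..clamp_to a s} f) \<circ> (\<lambda>t. t - l) has_vector_derivative 1 *\<^sub>R ?D t) (at t)"
      by (intro vector_diff_chain_at) (auto intro!: derivative_eq_intros)
    then have "((\<lambda>t. integral {-a..clamp_to a (t - l)} f) has_vector_derivative ?D t) (at t)"
      by (simp add: o_def)
    from has_vector_derivative_diff[OF has_vector_derivative_mult_right[OF this, of 2] has_vector_derivative_const]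
    show "(conv a (\<lambda>x. \<bar>x - l\<bar>) f' has_vector_derivative 2 * ?D t) (at t)"
      unfolding conv by simp
  qed (auto intro!: integrable_continuous_real continuous_intros cD cf)
  also have "integral {-a..a} (\<lambda>t. 2 * ?D t * cnj (f t)) = 2 * integral {-a..a} (\<lambda>t. ?D t * cnj (f t))"
    by (simp add: mult.assoc)
  finally have eq: "cmod (form a (\<lambda>x. \<bar>x - l\<bar>) f') = 2 * cmod (integral {-a..a} (\<lambda>t. ?D t * cnj (f t)))"
    by (simp add: norm_mult)
  have "(cmod (integral {-a..a} (\<lambda>t. ?D t * cnj (f t))))\<^sup>2 \<le> sqnorm a ?D * sqnorm a (\<lambda>t. cnj (f t))"
    by (intro cmod_integral_mult_le a cD continuous_intros cf)
  also have "sqnorm a (\<lambda>t. cnj (f t)) = sqnorm a f" by (simp add: sqnorm_def)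
  also have "sqnorm a ?D * sqnorm a f \<le> (sqnorm a f)\<^sup>2"
    unfolding power2_eq_square by (intro mult_right_mono sqnorm_shift_le cf a sqnorm_nonneg)
  finally have "cmod (integral {-a..a} (\<lambda>t. ?D t * cnj (f t))) \<le> sqnorm a f"
    by (rule power2_le_imp_le) simp
  with eq show ?thesis by simp
qed

subsection \<open>An upper Plancherel bound\<close>

definition hat :: "real \<Rightarrow> (real \<Rightarrow> complex) \<Rightarrow> real \<Rightarrow> complex" where
  "hat a f z = integral {-a..a} (\<lambda>u. cis (z * u) * f u)"

lemma continuous_on_hat:
  assumes "continuous_on {-a..a} f"
  shows "continuous_on S (hat a f)"
proof -
  have "continuous_on (S \<times> cbox (-a) a) (\<lambda>(z, u). cis (z * u) * f u)"
    unfolding split_def by (auto intro!: continuous_intros continuous_on_compose2[OF assms])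
  from integral_continuous_on_param[OF this] show ?thesis
    by (simp add: hat_def[abs_def])
qed

lemma integral_symmetric_split:
  fixes f :: "real \<Rightarrow> real"
  assumes c: "0 < c" and f: "continuous_on UNIV f"
  shows "integral {- (of_nat N * c)..of_nat N * c} f = (\<Sum>n\<in>{- int N..<int N}. integral {0..c} (\<lambda>s. f (s + c * of_int n)))"
proof (induction N)
  case (Suc N)
  have int: "f integrable_on {x..y}" for x y
    by (intro integrable_continuous_real continuous_on_subset[OF f]) simp
  have shift: "integral {0..c} (\<lambda>s. f (s + c * of_int n)) = integral {c * of_int n..c * of_int n + c} f" for n :: int
    using has_integral_affinity'[of f "integral {c * of_int n..c * of_int n + c} f" "c * of_int n" "c * of_int n + c" 1 "c * of_int n"] int
    by (simp add: integral_unique integrable_integral)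
  have "{- int (Suc N)..<int (Suc N)} = insert (- int N - 1) (insert (int N) {- int N..<int N})"
    by auto
  then have "(\<Sum>n\<in>{- int (Suc N)..<int (Suc N)}. integral {0..c} (\<lambda>s. f (s + c * of_int n))) =
     integral {c * of_int (- int N - 1)..c * of_int (- int N - 1) + c} f + (integral {c * of_int (int N)..c * of_int (int N) + c} f
      + integral {- (of_nat N * c)..of_nat N * c} f)"
    using Suc unfolding shift by simp
  also have "c * of_int (- int N - 1) = - (of_nat (Suc N) * c)" by (simp add: algebra_simps)
  also have "- (of_nat (Suc N) * c) + c = - (of_nat N * c)" by (simp add: algebra_simps)
  also have "c * of_int (int N) = of_nat N * c" by simp
  also have "of_nat N * c + c = of_nat (Suc N) * c" by (simp add: algebra_simps)
  also have "integral {- (of_nat (Suc N) * c)..- (of_nat N * c)} f + (integral {of_nat N * c..of_nat (Suc N) * c} f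
      + integral {- (of_nat N * c)..of_nat N * c} f) = integral {- (of_nat (Suc N) * c)..of_nat (Suc N) * c} f"
  proof -
    have le: "- (of_nat (Suc N) * c) \<le> - (of_nat N * c)" "- (of_nat N * c) \<le> of_nat N * c" "of_nat N * c \<le> of_nat (Suc N) * c"
      using c by (auto intro: order_trans[of _ 0])
    show ?thesis
      using Henstock_Kurzweil_Integration.integral_combine[OF le(1) order_trans[OF le(2,3)] int]
        Henstock_Kurzweil_Integration.integral_combine[OF le(2,3) int] by linarith
  qed
  finally show ?case by simp
qed simp

text \<open>Bessel's inequality along every translate of the lattice \<open>(\<pi>/a)\<int>\<close>, integrated over a
  fundamental cell, gives one half of Plancherel's theorem.\<close>

lemma integral_hat_le:
  assumes a: "0 < a" and f: "continuous_on {-a..a} f"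
  shows "integral {- (of_nat N * (pi / a))..of_nat N * (pi / a)} (\<lambda>z. (cmod (hat a f z))\<^sup>2) \<le> 2 * pi * sqnorm a f"
proof -
  let ?c = "pi / a" and ?h = "\<lambda>z. (cmod (hat a f z))\<^sup>2"
  have c: "0 < ?c" using a by simp
  have ch: "continuous_on S ?h" for S by (intro continuous_intros continuous_on_hat f)
  have ch': "continuous_on S (\<lambda>s. ?h (s + ?c * of_int n))" for S n
    by (intro continuous_on_compose2[OF ch[of UNIV]] continuous_intros) auto
  have "integral {- (of_nat N * ?c)..of_nat N * ?c} ?h = (\<Sum>n\<in>{- int N..<int N}. integral {0..?c} (\<lambda>s. ?h (s + ?c * of_int n)))"
    by (rule integral_symmetric_split[OF c ch])
  also have "\<dots> = integral {0..?c} (\<lambda>s. \<Sum>n\<in>{- int N..<int N}. ?h (s + ?c * of_int n))"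
    by (intro Henstock_Kurzweil_Integration.integral_sum[symmetric] integrable_continuous_real ch') simp
  also have "\<dots> \<le> integral {0..?c} (\<lambda>s. 2 * a * sqnorm a f)"
  proof (rule integral_le)
    fix s
    have "hat a f (s + ?c * of_int n) = integral {-a..a} (\<lambda>u. fbasis a n u * (cis (s * u) * f u))" for n
      unfolding hat_def fbasis_def mult.assoc[symmetric] cis_mult by (simp add: algebra_simps)
    then have "(\<Sum>n\<in>{- int N..<int N}. ?h (s + ?c * of_int n)) \<le> 2 * a * sqnorm a (\<lambda>u. cis (s * u) * f u)"
      using fourier_Bessel[OF a, of "\<lambda>u. cis (s * u) * f u" "{- int N..<int N}"] f
      by (simp add: continuous_intros)
    also have "sqnorm a (\<lambda>u. cis (s * u) * f u) = sqnorm a f"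
      by (simp add: sqnorm_def norm_mult)
    finally show "(\<Sum>n\<in>{- int N..<int N}. ?h (s + ?c * of_int n)) \<le> 2 * a * sqnorm a f" .
    show "(\<lambda>s. \<Sum>n\<in>{- int N..<int N}. ?h (s + ?c * of_int n)) integrable_on {0..?c}"
      by (intro integrable_sum integrable_continuous_real ch') simp
  qed (rule integrable_const_ivl)
  also have "\<dots> = 2 * pi * sqnorm a f" using a by simp
  finally show ?thesis .
qed

text \<open>The windows of \<open>integral_hat_le\<close> exhaust the line, so dominated convergence
  passes to the limit. In the non-integrable case the Bochner integral is 0 by convention and the
  bound is trivial.\<close>

lemma Plancherel_le:
  assumes a: "0 < a" and f: "continuous_on {-a..a} f"
  shows "(LINT z|lebesgue. (cmod (hat a f z))\<^sup>2) \<le> 2 * pi * sqnorm a f"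
proof (cases "integrable lebesgue (\<lambda>z. (cmod (hat a f z))\<^sup>2)")
  case True
  let ?h = "\<lambda>z. (cmod (hat a f z))\<^sup>2"
  let ?A = "\<lambda>N::nat. {- (of_nat N * (pi / a))..of_nat N * (pi / a)}"
  have ch: "continuous_on S ?h" for S by (intro continuous_intros continuous_on_hat f)
  have "(\<lambda>N. LINT z|lebesgue. indicator (?A N) z *\<^sub>R ?h z) \<longlonglongrightarrow> (LINT z|lebesgue. ?h z)"
  proof (rule integral_dominated_convergence[where w="?h"])
    show "AE z in lebesgue. (\<lambda>N. indicator (?A N) z *\<^sub>R ?h z) \<longlonglongrightarrow> ?h z"
    proof (intro AE_I2 tendsto_eventually)
      fix z :: real
      obtain M :: nat where M: "\<bar>z\<bar> * a / pi \<le> of_nat M" using real_arch_simple by blast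
      show "\<forall>\<^sub>F N in sequentially. indicator (?A N) z *\<^sub>R ?h z = ?h z"
        using eventually_ge_at_top[of M]
      proof eventually_elim
        case (elim N)
        then have "\<bar>z\<bar> * a / pi \<le> of_nat N" using M by linarith
        then have "\<bar>z\<bar> \<le> of_nat N * (pi / a)" using a by (simp add: field_simps)
        then show ?case by (auto simp: indicator_def abs_le_iff)
      qed
    qed
    show "(\<lambda>z. indicator (?A N) z *\<^sub>R ?h z) \<in> borel_measurable lebesgue" for N
      by (intro borel_measurable_integrable integrable_mult_indicator True) simp
  qed (use True in \<open>auto simp: indicator_def\<close>)
  then show ?thesis
  proof (rule LIMSEQ_le_const2, intro exI allI impI)
    fix N :: nat
    have "(LINT z|lebesgue. indicator (?A N) z *\<^sub>R ?h z) = integral (?A N) ?h"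
      using set_lebesgue_integral_eq_integral(2)[of "?A N" ?h] absolutely_integrable_continuous_real[OF ch]
      by (simp add: set_lebesgue_integral_def)
    then show "(LINT z|lebesgue. indicator (?A N) z *\<^sub>R ?h z) \<le> 2 * pi * sqnorm a f"
      using integral_hat_le[OF a f] by simp
  qed
qed (use a in \<open>simp add: not_integrable_integral_eq\<close>)

section \<open>Uniqueness almost everywhere from integrals over half-lines\<close>

lemma AE_eq_0_if_tail_integrals_0:
  fixes d :: "real \<Rightarrow> real"
  assumes d: "integrable lborel d" and 0: "\<And>x. (LINT y:{x<..}|lborel. d y) = 0"
  shows "AE x in lborel. d x = 0"
proof -
  have [measurable]: "d \<in> borel_measurable borel" using d by auto
  let ?p = "\<lambda>x. max 0 (d x)" and ?m = "\<lambda>x. max 0 (- d x)"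
  have int: "integrable lborel (\<lambda>y. indicator {x<..} y *\<^sub>R ?p y)" "integrable lborel (\<lambda>y. indicator {x<..} y *\<^sub>R ?m y)" for x
    by (intro integrable_mult_indicator integrable_max integrable_zero Bochner_Integration.integrable_minus d; simp)+
  have nn: "emeasure (density lborel (\<lambda>x. ennreal (q x))) {x<..} = ennreal (LINT y|lborel. indicator {x<..} y *\<^sub>R q y)"
    if "integrable lborel (\<lambda>y. indicator {x<..} y *\<^sub>R q y)" "\<And>x. 0 \<le> q x" "q \<in> borel_measurable borel" for q :: "real \<Rightarrow> real" and x
  proof -
    have "emeasure (density lborel (\<lambda>x. ennreal (q x))) {x<..} = (\<integral>\<^sup>+y. ennreal (indicator {x<..} y *\<^sub>R q y) \<partial>lborel)"
      using that(3) by (subst emeasure_density) (auto intro!: nn_integral_cong borel_open simp: indicator_def)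
    also have "\<dots> = ennreal (LINT y|lborel. indicator {x<..} y *\<^sub>R q y)"
      by (intro nn_integral_eq_integral that) (auto simp: that)
    finally show ?thesis .
  qed
  \<comment> \<open>The positive and the negative part of \<open>d\<close> are densities of measures
    that are finite and equal on all half-lines \<open>{x<..}\<close>, hence equal; uniqueness of
    densities then identifies the two parts almost everywhere.\<close>
  have "density lborel (\<lambda>x. ennreal (?p x)) = density lborel (\<lambda>x. ennreal (?m x))"
  proof (rule measure_eqI_lessThan)
    fix x
    show "emeasure (density lborel (\<lambda>x. ennreal (?p x))) {x<..} < \<infinity>"
      by (subst nn) (auto intro: int[simplified])
    have "(LINT y|lborel. indicator {x<..} y *\<^sub>R ?p y) - (LINT y|lborel. indicator {x<..} y *\<^sub>R ?m y) =
        (LINT y|lborel. indicator {x<..} y *\<^sub>R ?p y - indicator {x<..} y *\<^sub>R ?m y)"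
      by (rule Bochner_Integration.integral_diff[OF int, symmetric])
    also have "\<dots> = (LINT y:{x<..}|lborel. d y)"
      unfolding set_lebesgue_integral_def by (intro Bochner_Integration.integral_cong) (auto simp: indicator_def)
    finally show "emeasure (density lborel (\<lambda>x. ennreal (?p x))) {x<..} = emeasure (density lborel (\<lambda>x. ennreal (?m x))) {x<..}"
      using 0[of x] by (subst (1 2) nn) (auto intro: int[simplified])
  qed auto
  then have "AE x in lborel. ennreal (?p x) = ennreal (?m x)"
    by (intro sigma_finite_measure.density_unique[OF lborel.sigma_finite_measure_axioms]) auto
  then show ?thesis by eventually_elim (auto simp: max_def split: if_splits)
qed

text \<open>A Lebesgue measurable function agrees almost everywhere with a Borel function, which
  carries the Borel case over to the completion.\<close>

lemma AE_lebesgue_eq_0_if_tail_integrals_0_real: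
  fixes d :: "real \<Rightarrow> real"
  assumes d: "integrable lebesgue d" and 0: "\<And>x. (LINT y:{x<..}|lebesgue. d y) = 0"
  shows "AE x in lebesgue. d x = 0"
proof -
  obtain e where e[measurable]: "e \<in> borel_measurable lborel" and de: "AE x in lborel. d x = e x"
    using completion_ex_borel_measurable_real[OF borel_measurable_integrable[OF d]] by blast
  have de': "AE x in lebesgue. d x = e x" using AE_completion[OF de] .
  have [measurable]: "d \<in> borel_measurable lebesgue" using d by auto
  have e': "e \<in> borel_measurable lebesgue" using e by (rule measurable_completion)
  have "integrable lebesgue e"
    using integrable_cong_AE_imp[OF d e'] de' by (simp add: eq_commute)
  then have "integrable lborel e" using integrable_completion[OF e] by blast
  moreover have "(LINT y:{x<..}|lborel. e y) = 0" for x
  proof -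
    have "(LINT y:{x<..}|lborel. e y) = (LINT y:{x<..}|lebesgue. e y)"
      unfolding set_lebesgue_integral_def by (rule integral_completion[symmetric]) simp
    also have "\<dots> = (LINT y:{x<..}|lebesgue. d y)"
      using e' de' by (intro set_lebesgue_integral_cong_AE) auto
    finally show ?thesis using 0 by simp
  qed
  ultimately have "AE x in lborel. e x = 0" by (rule AE_eq_0_if_tail_integrals_0)
  then have "AE x in lebesgue. e x = 0" by (rule AE_completion)
  with de' show ?thesis by eventually_elim simp
qed

lemma AE_lebesgue_eq_0_if_tail_integrals_0:
  fixes d :: "real \<Rightarrow> complex"
  assumes d: "integrable lebesgue d" and 0: "\<And>x. (LINT y:{x<..}|lebesgue. d y) = 0"
  shows "AE x in lebesgue. d x = 0"
proof -
  have i: "integrable lebesgue (\<lambda>y. indicator {x<..} y *\<^sub>R d y)" for x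
    by (intro integrable_mult_indicator d) simp
  have "(LINT y:{x<..}|lebesgue. Re (d y)) = 0" for x
    using 0[of x] integral_Re[OF i[of x]] unfolding set_lebesgue_integral_def by simp
  then have "AE x in lebesgue. Re (d x) = 0"
    by (intro AE_lebesgue_eq_0_if_tail_integrals_0_real integrable_Re d)
  moreover have "(LINT y:{x<..}|lebesgue. Im (d y)) = 0" for x
    using 0[of x] integral_Im[OF i[of x]] unfolding set_lebesgue_integral_def by simp
  then have "AE x in lebesgue. Im (d x) = 0"
    by (intro AE_lebesgue_eq_0_if_tail_integrals_0_real integrable_Im d)
  ultimately show ?thesis by eventually_elim (simp add: complex_eq_iff)
qed

subsection \<open>Passing from \<open>\<phi>\<close> to a smooth representative\<close>

text \<open>\<open>I0 a \<phi>\<close> agrees on \<open>{-a..a}\<close> with a smooth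
  \<open>h\<close>, so \<open>\<phi>\<close> and \<open>h'\<close> have the same integrals over
  every \<open>{-a<..<s}\<close> and coincide almost everywhere. The end values of \<open>h\<close>
  are an integral over the empty interval and the total integral
  \<open>fourier \<phi> 0\<close>.\<close>

lemma frakK_N0E:
  assumes a: "0 < a" and \<phi>: "\<phi> \<in> frakK_N0 N a"
  obtains h h' where "continuous_on UNIV h'" "vanishing_primitive a h h'"
    "AE t in lebesgue. t \<in> {-a..a} \<longrightarrow> \<phi> t = h' t"
    "\<And>n. \<bar>n\<bar> \<le> int N \<Longrightarrow> integral {-a..a} (\<lambda>x. h x * fbasis a n x) = 0"
proof -
  have L2: "\<phi> \<in> L2 a" and f0: "fourier \<phi> 0 = 0" and KN: "I0 a \<phi> \<in> K_N N a"
    using \<phi> by (auto simp: frakK_N0_def)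
  from L2 have \<phi>m: "\<phi> \<in> borel_measurable lebesgue" and \<phi>2: "integrable lebesgue (\<lambda>t. (cmod (\<phi> t))\<^sup>2)"
    and \<phi>0: "\<And>t. t \<notin> {-a<..<a} \<Longrightarrow> \<phi> t = 0" by (auto simp: L2_def)
  obtain h where "smooth h" and I0: "\<And>t. I0 a \<phi> t = (if \<bar>t\<bar> \<le> a then h t else 0)"
    using KN by (auto simp: K_N_def K_def)
  then obtain D where D: "D 0 = h" "\<And>k t. (D k has_vector_derivative D (Suc k) t) (at t)"
    by (auto simp: smooth_def)
  define h' where "h' = D 1"
  have hd: "(h has_vector_derivative h' t) (at t)" for t using D(2)[of 0 t] D(1) by (simp add: h'_def)
  have ch': "continuous_on S h'" for S
    unfolding h'_def
    by (rule continuous_on_vector_derivative) (rule has_vector_derivative_at_within[OF D(2)])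
  have ch: "continuous_on S h" for S
    by (rule continuous_on_vector_derivative) (rule has_vector_derivative_at_within[OF hd])
  have "integrable lebesgue \<phi>"
  proof (rule Bochner_Integration.integrable_bound)
    show "integrable lebesgue (\<lambda>t. indicator {-a..a} t + (cmod (\<phi> t))\<^sup>2)"
      by (intro Bochner_Integration.integrable_add \<phi>2 integrable_real_indicator) (use a in auto)
    \<comment> \<open>Square integrability implies integrability on a bounded interval, through
      \<open>2 x \<le> 1 + x\<^sup>2\<close>.\<close>
    have "cmod (\<phi> t) \<le> indicator {-a..a} t + (cmod (\<phi> t))\<^sup>2" for t
    proof (cases "t \<in> {-a..a}")
      case True
      have "0 \<le> (cmod (\<phi> t) - 1)\<^sup>2" by simp
      then have "2 * cmod (\<phi> t) \<le> 1 + (cmod (\<phi> t))\<^sup>2" by (simp add: power2_diff)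
      with norm_ge_zero[of "\<phi> t"] have "cmod (\<phi> t) \<le> 1 + (cmod (\<phi> t))\<^sup>2" by linarith
      then show ?thesis using True by simp
    qed (use \<phi>0[of t] in auto)
    then show "AE t in lebesgue. cmod (\<phi> t) \<le> norm (indicator {-a..a} t + (cmod (\<phi> t))\<^sup>2)" by simp
  qed (rule \<phi>m)
  note \<phi>i = this
  have total: "(LINT t|lebesgue. \<phi> t) = 0" using f0 by (simp add: fourier_def)
  have I0_eq: "I0 a \<phi> t = (LINT u:{-a<..<t}|lebesgue. \<phi> u)" if "-a \<le> t" for t
    using that by (simp add: I0_def interval_lebesgue_integral_le_eq)
  have "h (-a) = 0"
    using I0[of "-a"] I0_eq[of "-a"] a by (simp add: set_lebesgue_integral_def)
  moreover have "h a = 0"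
  proof -
    have "h a = (LINT u:{-a<..<a}|lebesgue. \<phi> u)" using I0[of a] I0_eq[of a] a by simp
    also have "\<dots> = (LINT u|lebesgue. \<phi> u)"
      unfolding set_lebesgue_integral_def
      by (intro Bochner_Integration.integral_cong refl) (use \<phi>0 in \<open>auto simp: indicator_def\<close>)
    finally show ?thesis using total by simp
  qed
  ultimately have vp: "vanishing_primitive a h h'"
    using ch ch' hd by (simp add: vanishing_primitive_def)
  define d where "d t = \<phi> t - indicator {-a..a} t *\<^sub>R h' t" for t
  have h'i: "integrable lebesgue (\<lambda>t. indicator {-a..a} t *\<^sub>R h' t)"
    using absolutely_integrable_continuous_real[OF ch', of "-a" a] by (simp add: set_integrable_def)
  have di: "integrable lebesgue d"
    unfolding d_def by (intro Bochner_Integration.integrable_diff \<phi>i h'i)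
  have tail: "(LINT y:{x<..}|lebesgue. d y) = 0" for x
  proof -
    define c where "c = clamp_to a x"
    have c: "c \<in> {-a..a}" unfolding c_def by (rule clamp_to_mem[OF a])
    have h'_int: "(LINT u:{-a<..<s}|lebesgue. h' u) = h s" if "s \<in> {-a..a}" for s
    proof -
      have "set_integrable lebesgue {-a<..<s} h'"
        by (rule set_integrable_subset[OF absolutely_integrable_continuous_real[OF ch', of "-a" s]]) auto
      from set_lebesgue_integral_eq_integral(2)[OF this]
      have "(LINT u:{-a<..<s}|lebesgue. h' u) = integral {-a..s} h'" by (simp add: integral_open_interval_real)
      also have "\<dots> = h s"
        using fundamental_theorem_of_calculus[of "-a" s h h'] that hd \<open>h (-a) = 0\<close>
        by (auto simp: integral_unique has_vector_derivative_at_within)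
      finally show ?thesis .
    qed
    have int: "integrable lebesgue (\<lambda>t. indicator A t *\<^sub>R d t)" if "A \<in> sets lebesgue" for A
      by (intro integrable_mult_indicator di that)
    have part: "(LINT u:{-a<..<s}|lebesgue. d u) = 0" if s: "s \<in> {-a..a}" for s
    proof -
      have "(LINT u:{-a<..<s}|lebesgue. d u) =
          (LINT u|lebesgue. indicator {-a<..<s} u *\<^sub>R \<phi> u - indicator {-a<..<s} u *\<^sub>R h' u)"
        unfolding set_lebesgue_integral_def d_def using s
        by (intro Bochner_Integration.integral_cong refl) (auto simp: indicator_def)
      also have "\<dots> = (LINT u:{-a<..<s}|lebesgue. \<phi> u) - (LINT u:{-a<..<s}|lebesgue. h' u)"
        unfolding set_lebesgue_integral_def
      proof (rule Bochner_Integration.integral_diff)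
        show "integrable lebesgue (\<lambda>u. indicator {-a<..<s} u *\<^sub>R \<phi> u)" by (intro integrable_mult_indicator \<phi>i) simp
        have "set_integrable lebesgue {-a<..<s} h'"
          by (rule set_integrable_subset[OF absolutely_integrable_continuous_real[OF ch', of "-a" s]]) auto
        then show "integrable lebesgue (\<lambda>u. indicator {-a<..<s} u *\<^sub>R h' u)" by (simp add: set_integrable_def)
      qed
      also have "\<dots> = 0" using s I0[of s] I0_eq[of s] h'_int[OF s] by (simp add: abs_le_iff)
      finally show ?thesis .
    qed
    \<comment> \<open>Up to these three points, the half-line above \<open>x\<close> meets
      \<open>{-a<..<a}\<close> in the complement of \<open>{-a<..<c}\<close>.\<close>
    have "AE y in lebesgue. y \<notin> {c, a, -a}"
      by (intro AE_not_in) (auto intro!: null_sets_completionI countable_imp_null_set_lborel)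
    then have "AE y in lebesgue. indicator {x<..} y *\<^sub>R d y = indicator {-a<..<a} y *\<^sub>R d y - indicator {-a<..<c} y *\<^sub>R d y"
    proof eventually_elim
      case (elim y)
      show ?case
      proof (cases "y \<in> {-a<..<a}")
        case False
        then have "d y = 0" using elim \<phi>0[of y] by (auto simp: d_def indicator_def)
        then show ?thesis by simp
      next
        case True
        then show ?thesis using elim by (auto simp: c_def clamp_to_def indicator_def)
      qed
    qed
    then have "(LINT y:{x<..}|lebesgue. d y) =
        (LINT y|lebesgue. indicator {-a<..<a} y *\<^sub>R d y - indicator {-a<..<c} y *\<^sub>R d y)"
      unfolding set_lebesgue_integral_def
      by (intro integral_cong_AE borel_measurable_integrable Bochner_Integration.integrable_diff int) auto
    also have "\<dots> = (LINT y:{-a<..<a}|lebesgue. d y) - (LINT y:{-a<..<c}|lebesgue. d y)"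
      unfolding set_lebesgue_integral_def by (intro Bochner_Integration.integral_diff int) auto
    also have "\<dots> = 0" using part[OF c] part[of a] a by simp
    finally show ?thesis .
  qed
  have "AE t in lebesgue. d t = 0" by (rule AE_lebesgue_eq_0_if_tail_integrals_0[OF di tail])
  then have ae: "AE t in lebesgue. t \<in> {-a..a} \<longrightarrow> \<phi> t = h' t"
    by eventually_elim (simp add: d_def)
  have orth: "integral {-a..a} (\<lambda>x. h x * fbasis a n x) = 0" if "\<bar>n\<bar> \<le> int N" for n
  proof -
    have "integral {-a..a} (\<lambda>x. h x * fbasis a n x) = (LINT x:{-a..a}|lebesgue. h x * fbasis a n x)"
      by (intro set_lebesgue_integral_eq_integral(2)[symmetric] absolutely_integrable_continuous_real continuous_intros ch)
    also have "\<dots> = (LINT x:{-a..a}|lebesgue. I0 a \<phi> x * exp (pi * \<i> * of_int n * complex_of_real x / complex_of_real a))"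
      by (intro set_lebesgue_integral_cong) (auto simp: I0 abs_le_iff fbasis_def cis_conv_exp mult_ac)
    also have "\<dots> = 0" using KN that by (simp add: K_N_def)
    finally show ?thesis .
  qed
  show ?thesis by (rule that[OF ch' vp ae orth])
qed

section \<open>From Lebesgue integrals of \<open>\<phi>\<close> to gauge integrals of its
  representative\<close>

lemma set_integral_eq_integral_AE:
  assumes \<phi>: "\<phi> \<in> borel_measurable lebesgue" and q: "continuous_on UNIV q" and r: "continuous_on UNIV (r :: real \<Rightarrow> complex)"
    and ae: "AE t in lebesgue. t \<in> {-a..a} \<longrightarrow> \<phi> t = q t"
  shows "(LINT t:{-a..a}|lebesgue. r t * \<phi> t) = integral {-a..a} (\<lambda>t. r t * q t)"
proof -
  have m: "s \<in> borel_measurable lebesgue" if "continuous_on UNIV s" for s :: "real \<Rightarrow> complex"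
    using borel_measurable_continuous_onI[OF that] by (intro measurable_completion) simp
  have "(LINT t:{-a..a}|lebesgue. r t * \<phi> t) = (LINT t:{-a..a}|lebesgue. r t * q t)"
    using ae by (intro set_lebesgue_integral_cong_AE borel_measurable_times m q r \<phi>) (auto elim!: eventually_mono)
  also have "\<dots> = integral {-a..a} (\<lambda>t. r t * q t)"
    by (intro set_lebesgue_integral_eq_integral(2) absolutely_integrable_continuous_real continuous_intros
        continuous_on_subset[OF q] continuous_on_subset[OF r]) auto
  finally show ?thesis .
qed

lemma integral_vanishing_primitive_0:
  assumes "vanishing_primitive a h h'" "0 < a"
  shows "integral {-a..a} h' = 0"
  using integral_deriv_mult_vanishing_primitive[OF assms, of "\<lambda>_. 1" "\<lambda>_. 0"] by simp

text \<open>The summands of \<open>G_kernel\<close> that depend on at most one variable drop out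
  because \<open>h'\<close> has integral 0: \<open>k 0 - k t\<close> in the inner integral, and the
  one in \<open>u\<close> alone, which becomes the constant \<open>K1\<close>, in the outer
  one.\<close>

lemma G_form_eq_form:
  assumes a: "0 < a" and k: "continuous_on UNIV k" and h': "continuous_on UNIV h'" and vp: "vanishing_primitive a h h'"
    and \<phi>: "\<phi> \<in> borel_measurable lebesgue" and ae: "AE t in lebesgue. t \<in> {-a..a} \<longrightarrow> \<phi> t = h' t"
  shows "G_form k a \<phi> \<phi> = form a k h'"
proof -
  have h'S: "continuous_on S h'" for S using continuous_on_subset[OF h'] by simp
  have kc: "continuous_on S (\<lambda>x. k (f x))" if "continuous_on S f" for S f
    by (rule continuous_on_compose2[OF k that]) simp
  define K1 where "K1 = integral {-a..a} (\<lambda>u. of_real (k (-u)) * h' u)"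
  have inner: "(LINT u:{-a..a}|lebesgue. complex_of_real (G_kernel k t u) * \<phi> u * cnj (\<phi> t))
      = (conv a k h' t - K1) * cnj (\<phi> t)" for t
  proof -
    have "(LINT u:{-a..a}|lebesgue. complex_of_real (G_kernel k t u) * \<phi> u) =
        integral {-a..a} (\<lambda>u. complex_of_real (G_kernel k t u) * h' u)"
      by (rule set_integral_eq_integral_AE[OF \<phi> h' _ ae])
         (auto simp: G_kernel_def intro!: continuous_intros kc)
    also have "\<dots> = integral {-a..a} (\<lambda>u. (of_real (k (t - u)) * h' u - of_real (k (-u)) * h' u) + of_real (k 0 - k t) * h' u)"
      by (intro integral_cong) (simp add: G_kernel_def algebra_simps)
    also have "\<dots> = integral {-a..a} (\<lambda>u. of_real (k (t - u)) * h' u - of_real (k (-u)) * h' u)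
       + integral {-a..a} (\<lambda>u. of_real (k 0 - k t) * h' u)"
      by (intro Henstock_Kurzweil_Integration.integral_add integrable_continuous_real continuous_intros kc h'S)
    also have "integral {-a..a} (\<lambda>u. of_real (k (t - u)) * h' u - of_real (k (-u)) * h' u) = conv a k h' t - K1"
      unfolding conv_def K1_def
      by (intro Henstock_Kurzweil_Integration.integral_diff integrable_continuous_real continuous_intros kc h'S)
    finally have "(LINT u:{-a..a}|lebesgue. complex_of_real (G_kernel k t u) * \<phi> u) = conv a k h' t - K1"
      using integral_vanishing_primitive_0[OF vp a] by simp
    then show ?thesis by simp
  qed
  have "G_form k a \<phi> \<phi> = (LINT t:{-a..a}|lebesgue. (conv a k h' t - K1) * cnj (\<phi> t))"
    unfolding G_form_def inner ..
  also have "\<dots> = integral {-a..a} (\<lambda>t. (conv a k h' t - K1) * cnj (h' t))"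
  proof (rule set_integral_eq_integral_AE)
    show "(\<lambda>t. cnj (\<phi> t)) \<in> borel_measurable lebesgue"
      using measurable_compose[OF \<phi> borel_measurable_continuous_onI[OF continuous_on_cnj[OF continuous_on_id]]]
      by simp
    show "AE t in lebesgue. t \<in> {-a..a} \<longrightarrow> cnj (\<phi> t) = cnj (h' t)"
      using ae by eventually_elim simp
  qed (intro continuous_intros continuous_on_conv k h'S)+
  also have "\<dots> = integral {-a..a} (\<lambda>t. conv a k h' t * cnj (h' t)) - integral {-a..a} (\<lambda>t. K1 * cnj (h' t))"
    unfolding left_diff_distrib
    by (intro Henstock_Kurzweil_Integration.integral_diff integrable_continuous_real continuous_intros continuous_on_conv k h'S)
  also have "integral {-a..a} (\<lambda>t. K1 * cnj (h' t)) = 0"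
    using integral_vanishing_primitive_0[OF vp a] by (simp flip: integral_cnj)
  finally show ?thesis by (simp add: form_def)
qed

text \<open>Integration by parts turns the Fourier transform of \<open>\<phi>\<close> into
  \<open>- \<i> * z\<close> times \<open>hat a h z\<close>. Division by \<open>z\<close> therefore
  gives \<open>Phi1\<close> the modulus of \<open>hat a h\<close> off the null set of
  \<open>z = 0\<close>, and \<open>Plancherel_le\<close> applies.\<close>

lemma Phi1_norm_integral_le:
  assumes a: "0 < a" and h': "continuous_on UNIV h'" and vp: "vanishing_primitive a h h'"
    and \<phi>: "\<phi> \<in> L2 a" and ae: "AE t in lebesgue. t \<in> {-a..a} \<longrightarrow> \<phi> t = h' t"
  shows "(LINT z|lebesgue. (cmod (Phi1 \<phi> (complex_of_real z)))\<^sup>2) \<le> 2 * pi * sqnorm a h"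
proof -
  have \<phi>m: "\<phi> \<in> borel_measurable lebesgue" and \<phi>0: "\<And>t. t \<notin> {-a<..<a} \<Longrightarrow> \<phi> t = 0"
    using \<phi> by (auto simp: L2_def)
  have ch: "continuous_on {-a..a} h" using vp by (simp add: vanishing_primitive_def)
  have four: "fourier \<phi> (complex_of_real z) = - \<i> * of_real z * hat a h z" for z
  proof -
    have "fourier \<phi> (complex_of_real z) = (LINT t:{-a..a}|lebesgue. cis (z * t) * \<phi> t)"
      unfolding fourier_def set_lebesgue_integral_def
      by (intro Bochner_Integration.integral_cong refl)
         (use \<phi>0 in \<open>auto simp: indicator_def cis_conv_exp mult_ac\<close>)
    also have "\<dots> = integral {-a..a} (\<lambda>t. cis (z * t) * h' t)"
      by (intro set_integral_eq_integral_AE \<phi>m h' ae continuous_intros)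
    also have "\<dots> = - integral {-a..a} (\<lambda>t. (\<i> * of_real z * cis (z * t)) * h t)"
      by (intro integral_deriv_mult_vanishing_primitive[OF vp a] continuous_intros has_vector_derivative_cis)
    also have "\<dots> = - \<i> * of_real z * hat a h z"
      unfolding hat_def by (simp add: mult.assoc)
    finally show ?thesis .
  qed
  have P: "(cmod (Phi1 \<phi> (complex_of_real z)))\<^sup>2 = (cmod (hat a h z))\<^sup>2" if "z \<noteq> 0" for z
    using that four[of z] four[of 0] by (simp add: Phi1_def norm_mult norm_divide)
  have "AE z in lebesgue. (cmod (Phi1 \<phi> (complex_of_real z)))\<^sup>2 = (cmod (hat a h z))\<^sup>2"
  proof -
    have "AE z in lebesgue. z \<notin> {0::real}"
      by (intro AE_not_in) (auto intro!: null_sets_completionI)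
    then show ?thesis by eventually_elim (simp add: P)
  qed
  moreover have "(\<lambda>z. (cmod (hat a h z))\<^sup>2) \<in> borel_measurable borel"
    by (intro borel_measurable_continuous_onI continuous_intros continuous_on_hat ch)
  then have hm: "(\<lambda>z. (cmod (hat a h z))\<^sup>2) \<in> borel_measurable lebesgue"
    by (intro measurable_completion) simp
  moreover have "(\<lambda>z. (cmod (Phi1 \<phi> (complex_of_real z)))\<^sup>2) \<in> borel_measurable lebesgue"
  proof -
    have "(\<lambda>z. (cmod (Phi1 \<phi> (complex_of_real z)))\<^sup>2) =
        (\<lambda>z. if z = 0 then (cmod (Phi1 \<phi> 0))\<^sup>2 else (cmod (hat a h z))\<^sup>2)"
      using P by auto
    also have "\<dots> \<in> borel_measurable lebesgue"
      by (intro measurable_If hm) (auto intro: sets_completionI_sets)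
    finally show ?thesis .
  qed
  ultimately have "(LINT z|lebesgue. (cmod (Phi1 \<phi> (complex_of_real z)))\<^sup>2) = (LINT z|lebesgue. (cmod (hat a h z))\<^sup>2)"
    by (intro integral_cong_AE)
  then show ?thesis using Plancherel_le[OF a ch] by simp
qed

subsection \<open>Decomposition of \<open>g\<close>\<close>

definition rate :: "nat \<Rightarrow> real" where
  "rate n = 2 * real n + 1/2"

lemma rate_pos: "0 < rate n"
  by (simp add: rate_def)

lemma summable_inverse_rate_sq: "summable (\<lambda>n. 1 / (rate n)\<^sup>2)"
proof (rule summable_comparison_test')
  show "summable (\<lambda>n. 4 * (1 / (real n + 1)\<^sup>2))"
    using sums_summable[OF inverse_squares_sums] by (intro summable_mult) (simp add: add.commute)
  fix n :: nat
  have "((real n + 1) / 2)\<^sup>2 \<le> (rate n)\<^sup>2"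
    by (intro power_mono) (auto simp: rate_def)
  then have "1 / (rate n)\<^sup>2 \<le> 1 / ((real n + 1) / 2)\<^sup>2"
    using rate_pos[of n] by (intro divide_left_mono) auto
  then show "norm (1 / (rate n)\<^sup>2) \<le> 4 * (1 / (real n + 1)\<^sup>2)"
    by (simp add: power_divide)
qed

text \<open>The prime power terms are rewritten with
  \<open>max 0 (\<bar>x\<bar> - l) = (\<bar>x - l\<bar> + \<bar>x + l\<bar>) / 2 - l\<close> for \<open>l \<ge> 0\<close>; cutting off at a fixed \<open>m\<close>
  makes the decomposition uniform for \<open>\<bar>x\<bar> \<le> 2 a\<^sub>0\<close>.\<close>

definition regular_part :: "nat \<Rightarrow> real \<Rightarrow> real" where
  "regular_part m x =
     (8 - (pi\<^sup>2 + 8 * catalan_G) / 4)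
     + (- 4 * exp (1/2 * x) + (- 4 * exp (- 1/2 * x)
     + (- ((Digamma (1/4) - ln pi) / 2) * \<bar>x - 0\<bar>
     + (\<Sum>n\<in>{1..m}. mangoldt n / sqrt (real n) *
         (1/2 * \<bar>x - ln (real n)\<bar> + (1/2 * \<bar>x - (- ln (real n))\<bar> + - ln (real n)))))))"

definition exp_term :: "nat \<Rightarrow> real \<Rightarrow> real" where
  "exp_term n x = 1 / (rate n)\<^sup>2 * exp (- (rate n * \<bar>x\<bar>))"

lemma norm_exp_term_le: "norm (exp_term n x) \<le> 1 / (rate n)\<^sup>2"
  using rate_pos[of n] by (simp add: exp_term_def divide_simps)

lemma uniform_limit_exp_terms:
  "uniform_limit UNIV (\<lambda>k x. \<Sum>n<k. exp_term n x) (\<lambda>x. \<Sum>n. exp_term n x) sequentially"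
  by (rule Weierstrass_m_test[OF norm_exp_term_le summable_inverse_rate_sq])

lemma continuous_on_exp_term: "continuous_on S (exp_term n)"
  unfolding exp_term_def by (intro continuous_intros)

lemma continuous_on_suminf_exp_term: "continuous_on UNIV (\<lambda>x. \<Sum>n. exp_term n x)"
  by (rule uniform_limit_theorem[OF _ uniform_limit_exp_terms])
     (auto intro!: always_eventually continuous_on_sum continuous_on_exp_term)

lemma continuous_on_regular_part: "continuous_on S (regular_part m)"
  unfolding regular_part_def by (intro continuous_intros)

lemma regular_part_minus: "regular_part m (-x) = regular_part m x"
proof -
  have *: "1/2 * \<bar>- x - l\<bar> + (1/2 * \<bar>- x - (- l)\<bar> + - l) = 1/2 * \<bar>x - l\<bar> + (1/2 * \<bar>x - (- l)\<bar> + - l)"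
    for l :: real
    by (simp add: abs_if)
  show ?thesis unfolding regular_part_def * by simp
qed

lemma lerch_eq_suminf_exp_term:
  assumes "0 \<le> t"
  shows "1/4 * (exp (-t/2) * lerch_Phi (exp (-2*t)) 2 (1/4)) = (\<Sum>n. exp_term n t)"
proof -
  have "summable (\<lambda>n. exp_term n t)"
    by (rule summable_comparison_test'[OF summable_inverse_rate_sq norm_exp_term_le])
  then have "(\<lambda>n. 4 * exp (t/2) * exp_term n t) sums (4 * exp (t/2) * (\<Sum>n. exp_term n t))"
    by (intro sums_mult summable_sums)
  moreover have "4 * exp (t/2) * exp_term n t = (real n + 1/4) powr (-2) * exp (-2*t) ^ n" for n
  proof -
    have "exp (t/2) * exp (- (rate n * t)) = exp (-2*t) ^ n"
      unfolding exp_of_nat_mult[symmetric] exp_add[symmetric] by (simp add: rate_def algebra_simps)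
    \<comment> \<open>\<open>real n + 1/4\<close> is half of \<open>rate n\<close>, so the factor 4
      matches the \<open>1/4\<close> in front of the Lerch series.\<close>
    moreover have "(real n + 1/4) powr (-2) = 4 * (1 / (rate n)\<^sup>2)"
      by (simp add: powr_minus_divide rate_def power2_eq_square field_simps powr_numeral)
    ultimately show ?thesis using assms by (simp add: exp_term_def)
  qed
  ultimately have "lerch_Phi (exp (-2*t)) 2 (1/4) = 4 * exp (t/2) * (\<Sum>n. exp_term n t)"
    unfolding lerch_Phi_def by (simp add: sums_unique[symmetric])
  then show ?thesis
    by (simp flip: mult.assoc exp_add)
qed

lemma g_eq:
  assumes x: "\<bar>x\<bar> \<le> 2 * b"
  shows "g x = regular_part (nat \<lfloor>exp (2 * b)\<rfloor>) x + (\<Sum>n. exp_term n x)"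
proof -
  let ?m = "nat \<lfloor>exp (2 * b)\<rfloor>" and ?t = "\<bar>x\<bar>"
  let ?A = "{n::nat. 1 \<le> n \<and> real n \<le> exp ?t}"
  have pos: "real n \<le> exp s \<longleftrightarrow> ln (real n) \<le> s" if "1 \<le> n" for n s
    using that by (subst ln_le_cancel_iff[symmetric]) auto
  have sub: "?A \<subseteq> {1..?m}"
  proof
    fix n assume n: "n \<in> ?A"
    then have "real n \<le> exp (2 * b)" using x by (auto intro: order_trans)
    with n show "n \<in> {1..?m}" by (auto simp: le_nat_floor)
  qed
  \<comment> \<open>With \<open>max 0\<close> in place of the difference, every \<open>n\<close>
    with \<open>ln (real n) > \<bar>x\<bar>\<close> contributes 0, so the sum can be extended to a
    range that does not depend on \<open>x\<close>.\<close>
  have "(\<Sum>n\<in>?A. mangoldt n / sqrt (real n) * (?t - ln (real n)))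
      = (\<Sum>n\<in>?A. mangoldt n / sqrt (real n) * max 0 (?t - ln (real n)))"
    by (intro sum.cong) (auto simp: pos)
  also have "\<dots> = (\<Sum>n\<in>{1..?m}. mangoldt n / sqrt (real n) * max 0 (?t - ln (real n)))"
    using sub by (intro sum.mono_neutral_left) (auto simp: pos max_def)
  also have "\<dots> = (\<Sum>n\<in>{1..?m}. mangoldt n / sqrt (real n) *
         (1/2 * \<bar>x - ln (real n)\<bar> + (1/2 * \<bar>x - (- ln (real n))\<bar> + - ln (real n))))"
  proof (intro sum.cong refl)
    fix n assume "n \<in> {1..?m}"
    then have "0 \<le> ln (real n)" by (auto intro: ln_ge_zero)
    then have "max 0 (?t - ln (real n)) = 1/2 * \<bar>x - ln (real n)\<bar> + (1/2 * \<bar>x - (- ln (real n))\<bar> + - ln (real n))"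
      by (simp add: max_def abs_if field_simps)
    then show "mangoldt n / sqrt (real n) * max 0 (?t - ln (real n)) = mangoldt n / sqrt (real n) *
         (1/2 * \<bar>x - ln (real n)\<bar> + (1/2 * \<bar>x - (- ln (real n))\<bar> + - ln (real n)))" by simp
  qed
  finally have sum: "(\<Sum>n\<in>?A. mangoldt n / sqrt (real n) * (?t - ln (real n))) = \<dots>" .
  have ex: "exp (?t/2) + exp (-?t/2) = exp (1/2 * x) + exp (- 1/2 * x)"
    by (cases "0 \<le> x") (simp_all add: abs_if)
  have lerch: "1/4 * (exp (-?t/2) * lerch_Phi (exp (-2*?t)) 2 (1/4)) = (\<Sum>n. exp_term n x)"
    using lerch_eq_suminf_exp_term[of ?t] by (simp add: exp_term_def)
  show ?thesis
    unfolding g_def Psi_def Psi_nonneg_def sum ex regular_part_def lerch[symmetric] by (simp add: field_simps)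
qed

section \<open>Dependence of the forms on the kernel\<close>

lemma G_form_cong:
  assumes "\<And>x. \<bar>x\<bar> \<le> 2 * a \<Longrightarrow> f x = k x"
  shows "G_form f a \<phi> \<psi> = G_form k a \<phi> \<psi>"
proof -
  \<comment> \<open>The arguments \<open>t - u\<close>, \<open>t\<close>, \<open>-u\<close> and 0
    all have modulus at most \<open>2 * a\<close>.\<close>
  have "G_kernel f t u = G_kernel k t u" if "t \<in> {-a..a}" "u \<in> {-a..a}" for t u
    unfolding G_kernel_def using that by (intro arg_cong2[of _ _ _ _ "(+)"] arg_cong2[of _ _ _ _ "(-)"] assms) auto
  then show ?thesis
    unfolding G_form_def by (intro set_lebesgue_integral_cong) (auto intro!: set_lebesgue_integral_cong)
qed

lemma cmod_form_le:
  assumes a: "0 < a" and k: "continuous_on UNIV k" and \<phi>: "continuous_on {-a..a} \<phi>" and "\<And>x. \<bar>k x\<bar> \<le> e"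
  shows "cmod (form a k \<phi>) \<le> e * (integral {-a..a} (\<lambda>t. cmod (\<phi> t)))\<^sup>2"
proof -
  let ?I = "integral {-a..a} (\<lambda>t. cmod (\<phi> t))"
  have c: "cmod (conv a k \<phi> t) \<le> e * ?I" for t
  proof -
    have "cmod (conv a k \<phi> t) \<le> integral {-a..a} (\<lambda>u. e * cmod (\<phi> u))"
      unfolding conv_def
      by (intro Henstock_Kurzweil_Integration.integral_norm_bound_integral integrable_conv k \<phi>)
         (auto simp: norm_mult assms intro!: mult_right_mono integrable_continuous_real continuous_intros \<phi>)
    then show ?thesis by simp
  qed
  have "cmod (form a k \<phi>) \<le> integral {-a..a} (\<lambda>t. e * ?I * cmod (\<phi> t))"
    unfolding form_def
    by (intro Henstock_Kurzweil_Integration.integral_norm_bound_integral integrable_form k \<phi>)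
       (auto simp: norm_mult intro!: c mult_right_mono integrable_continuous_real continuous_intros \<phi>)
  then show ?thesis by (simp add: power2_eq_square mult.assoc)
qed

text \<open>By linearity the difference of two forms is the form of the difference kernel, which
  \<open>cmod_form_le\<close> bounds by a uniform bound on that kernel. This is how the exponential
  series enters term by term.\<close>

lemma form_tendsto:
  assumes a: "0 < a" and k: "\<And>n. continuous_on UNIV (k n)" and l: "continuous_on UNIV l" and \<phi>: "continuous_on {-a..a} \<phi>"
    and lim: "uniform_limit UNIV k l sequentially"
  shows "(\<lambda>n. form a (k n) \<phi>) \<longlonglongrightarrow> form a l \<phi>"
proof (rule LIMSEQ_I)
  fix r :: real assume r: "0 < r"
  define I where "I = (integral {-a..a} (\<lambda>t. cmod (\<phi> t)))\<^sup>2"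
  have I: "0 \<le> I" by (simp add: I_def)
  \<comment> \<open>The \<open>+ 1\<close> keeps the quotient meaningful for
    \<open>I = 0\<close>.\<close>
  define e where "e = r / (I + 1)"
  have e: "0 < e" "e * I < r" using r I by (auto simp: e_def field_simps)
  from uniform_limitD[OF lim e(1)] obtain N where N: "\<And>n x. N \<le> n \<Longrightarrow> dist (k n x) (l x) < e"
    by (auto simp: eventually_sequentially)
  have "norm (form a (k n) \<phi> - form a l \<phi>) < r" if "N \<le> n" for n
  proof -
    have "form a (\<lambda>x. k n x + (-1) * l x) \<phi> = form a (k n) \<phi> - form a l \<phi>"
      using form_add[OF k[of n] continuous_on_mult_left[OF l, of "-1"] \<phi>] form_cmult[of a "-1" l \<phi>] by simp
    moreover have "cmod (form a (\<lambda>x. k n x + (-1) * l x) \<phi>) \<le> e * I"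
      unfolding I_def using N[OF that]
      by (intro cmod_form_le a \<phi> continuous_intros k l) (auto simp: dist_real_def less_imp_le)
    ultimately show ?thesis using e(2) by simp
  qed
  then show "\<exists>N. \<forall>n\<ge>N. norm (form a (k n) \<phi> - form a l \<phi>) < r" by blast
qed

subsection \<open>The lower bound\<close>

text \<open>The summands account, in this order, for the two exponentials, each with coefficient
  \<open>-4\<close> and bound \<open>b * exp b / 2\<close>; for the kernel
  \<open>\<bar>x\<bar>\<close>; and for two shifted absolute values per \<open>n\<close>, each with
  weight \<open>1/2\<close> and bound 2.\<close>

definition regular_bound :: "real \<Rightarrow> nat \<Rightarrow> real" where
  "regular_bound b m = 4 * b * exp b + \<bar>Digamma (1/4) - ln pi\<bar> + (\<Sum>n\<in>{1..m}. 2 * (mangoldt n / sqrt (real n)))"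

lemma Re_form_regular_part_ge:
  assumes vp: "vanishing_primitive a h h'" and a: "0 < a" "a \<le> b"
  shows "- regular_bound b m * sqnorm a h \<le> Re (form a (regular_part m) h')"
proof -
  have ch': "continuous_on {-a..a} h'" using vp by (simp add: vanishing_primitive_def)
  define q where "q = sqnorm a h"
  have q: "0 \<le> q" by (simp add: q_def)
  define R where "R k = Re (form a k h')" for k
  have add: "R (\<lambda>x. k x + l x) = R k + R l" if "continuous_on UNIV k" "continuous_on UNIV l" for k l
    unfolding R_def using form_add[OF that ch'] by simp
  have cmult: "R (\<lambda>x. c * k x) = c * R k" for c k
    unfolding R_def form_cmult by simp
  have sum: "R (\<lambda>x. \<Sum>i\<in>I. k i x) = (\<Sum>i\<in>I. R (k i))" if "finite I" "\<And>i. i \<in> I \<Longrightarrow> continuous_on UNIV (k i)"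
    for I and k :: "nat \<Rightarrow> real \<Rightarrow> real"
    unfolding R_def using form_sum[OF that ch'] by simp
  \<comment> \<open>Constant kernels vanish because \<open>h'\<close> has integral 0; this disposes
    of the additive constant and of the terms \<open>- ln (real n)\<close>.\<close>
  have const: "R (\<lambda>x. c) = 0" for c
    unfolding R_def form_def conv_def using integral_vanishing_primitive_0[OF vp a(1)] by simp
  have abs: "- 2 * q \<le> R (\<lambda>x. \<bar>x - l\<bar>)" "R (\<lambda>x. \<bar>x - l\<bar>) \<le> 2 * q" for l
    using cmod_form_abs_shift_deriv_le[OF vp a(1), of l] abs_Re_le_cmod[of "form a (\<lambda>x. \<bar>x - l\<bar>) h'"]
    unfolding R_def q_def by linarith+
  have exp: "R (\<lambda>x. exp (c * x)) \<le> b * exp b / 2 * q" if "\<bar>c\<bar> = 1/2" for c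
  proof -
    have "c\<^sup>2 = \<bar>c\<bar>\<^sup>2" by simp
    also have "\<dots> = 1/4" unfolding that by (simp add: power2_eq_square)
    finally have c: "c\<^sup>2 = 1/4" .
    have "R (\<lambda>x. exp (c * x)) \<le> cmod (form a (\<lambda>x. exp (c * x)) h')"
      unfolding R_def by (rule complex_Re_le_cmod)
    also have "\<dots> \<le> c\<^sup>2 * (2 * a * exp (2 * \<bar>c\<bar> * a)) * q"
      unfolding q_def by (rule cmod_form_exp_deriv_le[OF vp a(1)])
    also have "\<dots> = a * exp a / 2 * q"
      unfolding that c by simp
    also have "\<dots> \<le> b * exp b / 2 * q"
      using a q by (intro mult_right_mono divide_right_mono mult_mono) auto
    finally show ?thesis .
  qed
  have "R (regular_part m) = - 4 * R (\<lambda>x. exp (1/2 * x)) + (- 4 * R (\<lambda>x. exp (- 1/2 * x))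
     + (- ((Digamma (1/4) - ln pi) / 2) * R (\<lambda>x. \<bar>x - 0\<bar>)
     + (\<Sum>n\<in>{1..m}. mangoldt n / sqrt (real n) *
         (1/2 * R (\<lambda>x. \<bar>x - ln (real n)\<bar>) + (1/2 * R (\<lambda>x. \<bar>x - (- ln (real n))\<bar>))))))"
    unfolding regular_part_def[abs_def]
    by (subst add sum cmult const; (intro continuous_intros finite_atLeastAtMost)?)+ simp
  also have "\<dots> \<ge> - 4 * (b * exp b / 2 * q) + (- 4 * (b * exp b / 2 * q) + (- \<bar>Digamma (1/4) - ln pi\<bar> * q
      + (\<Sum>n\<in>{1..m}. - 2 * (mangoldt n / sqrt (real n)) * q)))"
  proof (intro add_mono sum_mono)
    show "- 4 * (b * exp b / 2 * q) \<le> - 4 * R (\<lambda>x. exp (1/2 * x))" using exp[of "1/2"] by (simp add: mult_ac)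
    show "- 4 * (b * exp b / 2 * q) \<le> - 4 * R (\<lambda>x. exp (- 1/2 * x))" using exp[of "- 1/2"] by (simp add: mult_ac)
    have "\<bar>- ((Digamma (1/4) - ln pi) / 2) * R (\<lambda>x. \<bar>x - 0\<bar>)\<bar> \<le> \<bar>Digamma (1/4) - ln pi\<bar> / 2 * (2 * q)"
      unfolding abs_mult using abs[of 0] by (intro mult_mono) auto
    then show "- \<bar>Digamma (1/4) - ln pi\<bar> * q \<le> - ((Digamma (1/4) - ln pi) / 2) * R (\<lambda>x. \<bar>x - 0\<bar>)" by simp
    fix n assume "n \<in> {1..m}"
    have "- 2 * (mangoldt n / sqrt (real n)) * q = mangoldt n / sqrt (real n) * (- 2 * q)"
      by simp
    also have "\<dots> \<le> mangoldt n / sqrt (real n) *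
         (1/2 * R (\<lambda>x. \<bar>x - ln (real n)\<bar>) + (1/2 * R (\<lambda>x. \<bar>x - (- ln (real n))\<bar>)))"
      using abs(1)[of "ln (real n)"] abs(1)[of "- ln (real n)"] by (intro mult_left_mono) (auto simp: mangoldt_nonneg)
    finally show "- 2 * (mangoldt n / sqrt (real n)) * q \<le> mangoldt n / sqrt (real n) *
         (1/2 * R (\<lambda>x. \<bar>x - ln (real n)\<bar>) + (1/2 * R (\<lambda>x. \<bar>x - (- ln (real n))\<bar>)))" .
  qed
  finally show ?thesis
    unfolding R_def q_def[symmetric] regular_bound_def
    by (simp add: algebra_simps sum_negf sum_distrib_left)
qed

lemma Re_form_exp_term_nonneg:
  assumes "0 < a" "continuous_on {-a..a} \<phi>"
  shows "0 \<le> Re (form a (exp_term n) \<phi>)"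
  unfolding exp_term_def[abs_def] form_cmult
  using Re_form_exp_abs_nonneg[OF assms(1) less_imp_le[OF rate_pos] assms(2), of n] by simp

text \<open>The identity \<open>form_exp_abs_deriv\<close> is used twice. For \<open>h'\<close> it
  gives the main term with \<open>2 / rate n\<close> minus the form of \<open>h\<close>; for
  \<open>h\<close>, as the derivative of \<open>?F\<close>, it bounds that form by
  \<open>2 * rate n * sqnorm a ?F\<close>, which orthogonality controls.\<close>

lemma Re_form_exp_term_deriv_ge:
  assumes vp: "vanishing_primitive a h h'" and a: "0 < a"
    and orth: "\<And>n. \<bar>n\<bar> \<le> int N \<Longrightarrow> integral {-a..a} (\<lambda>x. h x * fbasis a n x) = 0"
  shows "(2 / rate n - 2 * rate n * (a\<^sup>2 * basel_defect N)) * sqnorm a h \<le> Re (form a (exp_term n) h')"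
proof -
  let ?k = "\<lambda>x. exp (- (rate n * \<bar>x\<bar>))" and ?F = "\<lambda>t. integral {-a..t} h"
  have ch: "continuous_on {-a..a} h" using vp by (simp add: vanishing_primitive_def)
  have cF: "continuous_on {-a..a} ?F"
    by (rule indefinite_integral_continuous_1) (rule integrable_continuous_real[OF ch])
  \<comment> \<open>Orthogonality to frequency 0 makes \<open>?F\<close> vanish at \<open>a\<close>
    as well as at \<open>-a\<close>.\<close>
  have "integral {-a..a} h = 0" using orth[of 0] by (simp add: fbasis_def)
  then have F: "vanishing_primitive a ?F h"
    using ch cF has_vector_derivative_integral_interior[OF ch] by (simp add: vanishing_primitive_def)
  have "Re (form a ?k h) = 2 * rate n * sqnorm a ?F - (rate n)\<^sup>2 * Re (form a ?k ?F)"
    unfolding form_exp_abs_deriv[OF F a] by (simp flip: of_real_power)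
  also have "\<dots> \<le> 2 * rate n * sqnorm a ?F"
    using Re_form_exp_abs_nonneg[OF a less_imp_le[OF rate_pos] cF, of n] by simp
  also have "\<dots> \<le> 2 * rate n * (a\<^sup>2 * basel_defect N * sqnorm a h)"
    using sqnorm_indefinite_integral_le[OF a ch orth] rate_pos[of n] by (intro mult_left_mono) auto
  finally have "Re (form a ?k h) \<le> 2 * rate n * (a\<^sup>2 * basel_defect N * sqnorm a h)" .
  moreover have "Re (form a (exp_term n) h') = 2 / rate n * sqnorm a h - Re (form a ?k h)"
    unfolding exp_term_def[abs_def] form_cmult form_exp_abs_deriv[OF vp a]
    using rate_pos[of n] by (simp add: field_simps power2_eq_square)
  ultimately show ?thesis by (simp add: left_diff_distrib mult.assoc)
qed

theorem theorem4p3: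
  fixes a0 \<mu> :: real
  assumes "a0 > 0" and "\<mu> > 0"
  shows "\<exists>N::nat. \<forall>a \<phi>. 0 < a \<and> a \<le> a0 \<and> \<phi> \<in> frakK_N0 N a \<longrightarrow>
           G_form g a \<phi> \<phi> \<in> \<real> \<and>
           Re (G_form g a \<phi> \<phi>) \<ge> \<mu> * (LINT z|lebesgue. (cmod (Phi1 \<phi> (complex_of_real z)))\<^sup>2)"
proof -
  \<comment> \<open>For \<open>t\<close> and \<open>u\<close> in \<open>{-a..a}\<close> the argument
    \<open>t - u\<close> has modulus at most \<open>2 * a0\<close>, so prime powers beyond
    \<open>exp (2 * a0)\<close> contribute nothing. The cutoff, and hence \<open>C\<close>, is the
    same for all \<open>a \<le> a0\<close>.\<close>
  let ?m = "nat \<lfloor>exp (2 * a0)\<rfloor>"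
  define C where "C = regular_bound a0 ?m"
  \<comment> \<open>\<open>C\<close> pays for the regular part, \<open>2 * pi * \<mu>\<close> is the
    target set by \<open>Phi1_norm_integral_le\<close>, and 1 is reserved for the errors that
    \<open>N\<close> will control.\<close>
  obtain M where M: "C + 2 * pi * \<mu> + 1 \<le> (\<Sum>n<M. 2 / rate n)"
  proof -
    obtain M :: nat where "exp (C + 2 * pi * \<mu> + 1) \<le> real M" using real_arch_simple by blast
    then have "exp (C + 2 * pi * \<mu> + 1) \<le> real M + 1" by simp
    then have "C + 2 * pi * \<mu> + 1 \<le> ln (real M + 1)"
      by (subst ln_ge_iff) (auto intro: add_nonneg_pos)
    also have "\<dots> \<le> harm M" by (rule ln_le_harm)
    also have "\<dots> = (\<Sum>n<M. 1 / (real n + 1))"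
      by (induction M) (simp_all add: harm_def harm_Suc inverse_eq_divide add.commute)
    \<comment> \<open>Termwise, since \<open>rate n \<le> 2 * (real n + 1)\<close>.\<close>
    also have "\<dots> \<le> (\<Sum>n<M. 2 / rate n)"
      by (intro sum_mono) (simp add: rate_def field_simps)
    finally show ?thesis by (rule that)
  qed
  \<comment> \<open>\<open>B\<close> times the modulus of the defect dominates the total error of
    the first \<open>M\<close> terms for every \<open>a \<le> a0\<close>; thus \<open>N\<close>
    depends on \<open>M\<close> but not on \<open>a\<close>.\<close>
  define B where "B = a0\<^sup>2 * (\<Sum>n<M. 2 * rate n)"
  have B: "0 \<le> B"
    unfolding B_def by (intro mult_nonneg_nonneg sum_nonneg) (auto simp: rate_pos less_imp_le)
  obtain N where N: "\<bar>basel_defect N\<bar> * B \<le> 1"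
  proof -
    have "\<forall>\<^sub>F N in sequentially. \<bar>basel_defect N\<bar> < 1 / (B + 1)"
      using tendstoD[OF basel_defect_tendsto_0, of "1 / (B + 1)"] B by simp
    then obtain N where "\<bar>basel_defect N\<bar> < 1 / (B + 1)"
      by (auto simp: eventually_sequentially)
    then have "\<bar>basel_defect N\<bar> * B \<le> 1 / (B + 1) * B"
      using B by (intro mult_right_mono) auto
    also have "\<dots> \<le> 1" using B by simp
    finally show ?thesis by (rule that)
  qed
  show ?thesis
  proof (intro exI allI impI)
    fix a \<phi>
    assume "0 < a \<and> a \<le> a0 \<and> \<phi> \<in> frakK_N0 N a"
    then have a: "0 < a" "a \<le> a0" and \<phi>: "\<phi> \<in> frakK_N0 N a" by auto
    obtain h h' where h': "continuous_on UNIV h'" and vp: "vanishing_primitive a h h'"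
      and ae: "AE t in lebesgue. t \<in> {-a..a} \<longrightarrow> \<phi> t = h' t"
      and orth: "\<And>n. \<bar>n\<bar> \<le> int N \<Longrightarrow> integral {-a..a} (\<lambda>x. h x * fbasis a n x) = 0"
      using frakK_N0E[OF a(1) \<phi>] by metis
    have L2: "\<phi> \<in> L2 a" using \<phi> by (simp add: frakK_N0_def)
    then have m: "\<phi> \<in> borel_measurable lebesgue" by (simp add: L2_def)
    have ch': "continuous_on {-a..a} h'" using h' by (rule continuous_on_subset) simp
    define q where "q = sqnorm a h"
    have q: "0 \<le> q" by (simp add: q_def)
    define l where "l x = regular_part ?m x + (\<Sum>n. exp_term n x)" for x
    \<comment> \<open>Truncations of \<open>l\<close>: the lower bound is proved for these and
      survives the limit.\<close>
    define k where "k K x = regular_part ?m x + (\<Sum>n<K. exp_term n x)" for K x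
    have cl: "continuous_on UNIV l"
      unfolding l_def by (intro continuous_on_add continuous_on_regular_part continuous_on_suminf_exp_term)
    have cs: "continuous_on UNIV (\<lambda>x. \<Sum>n<K. exp_term n x)" for K
      by (intro continuous_on_sum continuous_on_exp_term)
    have ck: "continuous_on UNIV (k K)" for K
      unfolding k_def by (intro continuous_on_add continuous_on_regular_part cs)
    have "G_form g a \<phi> \<phi> = G_form l a \<phi> \<phi>"
      by (rule G_form_cong) (use a g_eq[of _ a0] in \<open>auto simp: l_def\<close>)
    also have "\<dots> = form a l h'"
      by (rule G_form_eq_form[OF a(1) cl h' vp m ae])
    finally have G: "G_form g a \<phi> \<phi> = form a l h'" .
    have even: "l (-x) = l x" for x
      unfolding l_def regular_part_minus exp_term_def by simp
    have lim: "(\<lambda>K. Re (form a (k K) h')) \<longlonglongrightarrow> Re (form a l h')"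
    proof (intro tendsto_Re form_tendsto a ck cl ch')
      show "uniform_limit UNIV k l sequentially"
        unfolding k_def l_def
        by (intro uniform_limit_add uniform_limit_const uniform_limit_exp_terms)
    qed
    \<comment> \<open>The first \<open>M\<close> exponential terms receive the quantitative bound;
      those from \<open>M\<close> up to \<open>K\<close> are merely nonnegative.\<close>
    have bound: "2 * pi * \<mu> * q \<le> Re (form a (k K) h')" if K: "M \<le> K" for K
    proof -
      have "2 * pi * \<mu> \<le> - C + ((\<Sum>n<M. 2 / rate n) - 1)" using M by simp
      also have "\<dots> \<le> - C + (\<Sum>n<M. 2 / rate n - 2 * rate n * (a\<^sup>2 * basel_defect N))"
      proof -
        have "(\<Sum>n<M. 2 * rate n * (a\<^sup>2 * basel_defect N)) = (a\<^sup>2 * (\<Sum>n<M. 2 * rate n)) * basel_defect N"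
          by (simp add: sum_distrib_left sum_distrib_right mult_ac)
        also have "\<dots> \<le> (a\<^sup>2 * (\<Sum>n<M. 2 * rate n)) * \<bar>basel_defect N\<bar>"
          by (intro mult_left_mono mult_nonneg_nonneg sum_nonneg) (auto simp: rate_pos less_imp_le)
        also have "\<dots> \<le> B * \<bar>basel_defect N\<bar>"
          unfolding B_def using a
          by (intro mult_right_mono sum_nonneg power_mono) (auto simp: rate_pos less_imp_le)
        also have "\<dots> \<le> 1" using N by (simp add: mult.commute)
        finally show ?thesis by (simp add: sum_subtractf)
      qed
      finally have "2 * pi * \<mu> * q \<le> (- C + (\<Sum>n<M. 2 / rate n - 2 * rate n * (a\<^sup>2 * basel_defect N))) * q"
        by (rule mult_right_mono[OF _ q])
      also have "\<dots> = - C * q + (\<Sum>n<M. (2 / rate n - 2 * rate n * (a\<^sup>2 * basel_defect N)) * q)"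
        by (simp only: distrib_right sum_distrib_right)
      also have "\<dots> \<le> Re (form a (regular_part ?m) h') + (\<Sum>n<M. Re (form a (exp_term n) h'))"
        unfolding C_def q_def
        by (intro add_mono sum_mono Re_form_regular_part_ge Re_form_exp_term_deriv_ge vp a orth)
      also have "\<dots> \<le> Re (form a (regular_part ?m) h') + (\<Sum>n<K. Re (form a (exp_term n) h'))"
        using K by (intro add_left_mono sum_mono2 Re_form_exp_term_nonneg a ch') auto
      also have "\<dots> = Re (form a (k K) h')"
        unfolding k_def form_add[OF continuous_on_regular_part cs ch']
        by (simp add: form_sum[OF _ continuous_on_exp_term ch'])
      finally show ?thesis .
    qed
    have "\<mu> * (LINT z|lebesgue. (cmod (Phi1 \<phi> (complex_of_real z)))\<^sup>2) \<le> \<mu> * (2 * pi * q)"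
      unfolding q_def using assms(2) by (intro mult_left_mono Phi1_norm_integral_le[OF a(1) h' vp L2 ae]) simp
    also have "\<dots> \<le> Re (form a l h')"
      using LIMSEQ_le_const[OF lim, of "2 * pi * \<mu> * q"] bound by (auto simp: mult_ac)
    finally show "G_form g a \<phi> \<phi> \<in> \<real> \<and>
        Re (G_form g a \<phi> \<phi>) \<ge> \<mu> * (LINT z|lebesgue. (cmod (Phi1 \<phi> (complex_of_real z)))\<^sup>2)"
      unfolding G using form_in_Reals[OF cl even ch'] by blast
  qed
qed

end
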